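(* Let $V$ be an $n$-dimensional vector space ($n\ge 2$) over $\mathbb{F}_q$ of characteristic $p$, and let $s=1+u\otimes\phi$, $t=1+v\otimes\psi$ be transvections in $\mathrm{SL}(V)$ such that $\psi(u)\ne 0$ and $\phi(v)\ne 0$. Let $K,\Lambda\subseteq\mathbb{F}_q^\times$ be subsets containing $1$, let $\delta=w(s,t)=\psi(u)\phi(v)$ and $M=\mathbb{F}_p(K,\Lambda,\delta)$. Unless $p=2$ or $M=\mathbb{F}_9$, we have $\langle s^{K},t^{\Lambda}\rangle\simeq \mathrm{SL}(2,M)\oplus 1_{n-2}$.
   Context: For a transvection $r=1+a\otimes\chi$ (i.e. $x\mapsto x+\chi(x)a$, $\chi(a)=0$) and $\lambda\in\mathbb{F}_q$, $r^\lambda:=1+\lambda a\otimes\chi$, and $r^{K}=\{r^\kappa:\kappa\in K\}$. For a subgroup $H\le \mathrm{SL}(V)$ and a matrix group $N\le\mathrm{SL}(2,q)$, $H\simeq N\oplus 1_{n-2}$ means: there is a decomposition $V=U\oplus W$ with $\dim U=2$ and a subgroup $H_0\le\mathrm{SL}(U)$ such that $H=\{g: g(U)=U,\ g|_W=\mathrm{id}_W,\ g|_U\in H_0\}$ and the matrix form of $H_0$ in a suitable basis of $U$ equals $N$. $\mathrm{SL}(2,M)\le\mathrm{SL}(2,q)$ denotes the matrices with entries in the subfield $M$. *)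

theory Defs
  imports "HOL-Analysis.Analysis"
begin

text \<open>Linear functionals on 'a^'n are represented by coefficient vectors.\<close>

definition appf :: "'a::comm_ring_1 ^ 'n \<Rightarrow> 'a ^ 'n \<Rightarrow> 'a" where
  "appf f x = (\<Sum>i\<in>UNIV. f $ i * x $ i)"

text \<open>The map 1 + lambda a (x) chi, i.e. x |-> x + lambda chi(x) a, as a matrix.\<close>
definition transv :: "'a::comm_ring_1 \<Rightarrow> 'a ^ 'n \<Rightarrow> 'a ^ 'n \<Rightarrow> 'a ^ 'n ^ 'n" where
  "transv l a f = (\<chi> i j. (if i = j then 1 else 0) + l * a $ i * f $ j)"

definition transv_pow :: "'a::comm_ring_1 ^ 'n \<Rightarrow> 'a ^ 'n \<Rightarrow> 'a set \<Rightarrow> ('a ^ 'n ^ 'n) set" where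
  "transv_pow a f K = {transv \<kappa> a f | \<kappa>. \<kappa> \<in> K}"

inductive_set gen_group :: "('a::field ^ 'n ^ 'n) set \<Rightarrow> ('a ^ 'n ^ 'n) set"
  for S where
  one: "mat 1 \<in> gen_group S"
| gen: "g \<in> S \<Longrightarrow> g \<in> gen_group S"
| mult: "g \<in> gen_group S \<Longrightarrow> h \<in> gen_group S \<Longrightarrow> g ** h \<in> gen_group S"
| inv: "g \<in> gen_group S \<Longrightarrow> matrix_inv g \<in> gen_group S"

definition is_subfield :: "'a::field set \<Rightarrow> bool" where
  "is_subfield F \<longleftrightarrow> 0 \<in> F \<and> 1 \<in> F \<and> (\<forall>x\<in>F. \<forall>y\<in>F. x + y \<in> F \<and> x * y \<in> F)
     \<and> (\<forall>x\<in>F. - x \<in> F \<and> inverse x \<in> F)"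

definition subfield_gen :: "'a::field set \<Rightarrow> 'a set" where
  "subfield_gen S = \<Inter>{F. is_subfield F \<and> S \<subseteq> F}"

text \<open>H \<simeq> SL(2,M) \<oplus> 1_{n-2}: V = span{b1,b2} \<oplus> W and H consists exactly of the maps fixing W
  pointwise and acting on span{b1,b2} by a matrix of SL(2,M) in the basis b1,b2.\<close>
definition is_subspace :: "('a::field ^ 'n) set \<Rightarrow> bool" where
  "is_subspace W \<longleftrightarrow> 0 \<in> W \<and> (\<forall>x\<in>W. \<forall>y\<in>W. x + y \<in> W) \<and> (\<forall>c. \<forall>x\<in>W. c *s x \<in> W)"

definition SL2_plus_id :: "('a::field ^ 'n ^ 'n) set \<Rightarrow> 'a set \<Rightarrow> bool" where
  "SL2_plus_id H M \<longleftrightarrow> (\<exists>b1 b2 W. is_subspace W \<and>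
     (\<forall>x. \<exists>!(\<alpha>, \<beta>, w). w \<in> W \<and> x = \<alpha> *s b1 + \<beta> *s b2 + w) \<and>
     H = {g. \<exists>a b c d. a \<in> M \<and> b \<in> M \<and> c \<in> M \<and> d \<in> M \<and> a * d - b * c = 1 \<and>
              g *v b1 = a *s b1 + c *s b2 \<and> g *v b2 = b *s b1 + d *s b2 \<and>
              (\<forall>w\<in>W. g *v w = w)})"

end

theory Submission
  imports Defs "HOL-Algebra.Algebraic_Closure_Type"
begin

text \<open>
  In the basis \<phi>(v) u, v of a complement to W = ker \<phi> \<inter> ker \<psi>, the generators become the unitriangular
  matrices with entry \<kappa> above, respectively \<lambda>\<delta> below, the diagonal. So the theorem is an
  extension of Dickson's theorem on two-generator subgroups of SL(2,q).

  Let G be the group generated by these matrices and -1, acting on the projective line over the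
  algebraic closure. Counting fixed points gives a Riemann-Hurwitz formula, which shows
  that all points fixed by nontrivial unipotents form a single orbit \<Omega>, and that
  exactly one other orbit has nontrivial stabilizers modulo -1. Let U be the additive group of
  all a such that the upper unitriangular matrix with entry a lies in G, and Q = |U|. Comparing the two
  orbit sizes with |G| leaves only two possibilities: |\<Omega>| = Q + 1, or Q = 3 and |\<Omega>| = 10.

  In the first case \<Omega> is U together with infinity, and this forces U to be a field which also
  parametrizes the lower unitriangular matrices of G; so U contains \<kappa>, \<lambda> and \<delta>.
  In the second case K and \<Lambda> lie in the prime field with three elements, and if \<delta> does not, then
  \<Omega> is the projective line over the field with nine elements, which is generated by \<delta>.
\<close>

section \<open>Two-by-two matrices and their Moebius action\<close>

datatype 'a m2 = Mat2 'a 'a 'a 'a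

fun mmul :: "'a::field m2 \<Rightarrow> 'a m2 \<Rightarrow> 'a m2" (infixl "\<odot>" 70) where
  "(Mat2 a b c d) \<odot> (Mat2 a' b' c' d') = Mat2 (a * a' + b * c') (a * b' + b * d') (c * a' + d * c') (c * b' + d * d')"

fun minv :: "'a::field m2 \<Rightarrow> 'a m2" where
  "minv (Mat2 a b c d) = Mat2 d (- b) (- c) a"

fun mneg :: "'a::field m2 \<Rightarrow> 'a m2" where
  "mneg (Mat2 a b c d) = Mat2 (- a) (- b) (- c) (- d)"

fun mdet :: "'a::field m2 \<Rightarrow> 'a" where
  "mdet (Mat2 a b c d) = a * d - b * c"

fun mtr :: "'a::field m2 \<Rightarrow> 'a" where
  "mtr (Mat2 a b c d) = a + d"

definition mone :: "'a::field m2" where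
  "mone = Mat2 1 0 0 1"

definition upper :: "'a::field \<Rightarrow> 'a m2" where
  "upper x = Mat2 1 x 0 1"

definition lower :: "'a::field \<Rightarrow> 'a m2" where
  "lower x = Mat2 1 0 x 1"

text \<open>The Moebius action on the projective line, with \<^term>\<open>None\<close> as the point at infinity.\<close>

fun act :: "'a::field m2 \<Rightarrow> 'a option \<Rightarrow> 'a option" where
  "act (Mat2 a b c d) None = (if c = 0 then None else Some (a / c))"
| "act (Mat2 a b c d) (Some x) = (if c * x + d = 0 then None else Some ((a * x + b) / (c * x + d)))"

lemma mmul_assoc: "(g \<odot> h) \<odot> k = g \<odot> (h \<odot> k)"
  by (cases g; cases h; cases k) (simp add: algebra_simps)

lemma mmul_mone [simp]: "mone \<odot> g = g" "g \<odot> mone = g"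
  by (cases g; simp add: mone_def)+

lemma mneg_mmul: "mneg g \<odot> h = mneg (g \<odot> h)" "g \<odot> mneg h = mneg (g \<odot> h)"
  by (cases g; cases h; simp)+

lemma mneg_mneg [simp]: "mneg (mneg g) = g"
  by (cases g) simp

lemma mdet_mmul: "mdet (g \<odot> h) = mdet g * mdet h"
  by (cases g; cases h) (simp add: algebra_simps)

lemma minv_mmul [simp]:
  assumes "mdet g = 1" shows "minv g \<odot> g = mone" "g \<odot> minv g = mone"
  using assms by (cases g; simp add: mone_def algebra_simps)+

lemma mtr_commute: "mtr (g \<odot> h) = mtr (h \<odot> g)"
  by (cases g; cases h) (simp add: algebra_simps)

lemma mtr_mneg [simp]: "mtr (mneg g) = - mtr g"
  by (cases g) simp

lemma mneg_neq:
  assumes "(2::'a::field) \<noteq> 0" "mdet (g :: 'a m2) = 1"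
  shows "mneg g \<noteq> g"
proof
  assume *: "mneg g = g"
  obtain a b c d where g: "g = Mat2 a b c d" by (cases g)
  have "x = 0" if "- x = x" for x :: 'a
  proof -
    have "2 * x = x + x" by (rule mult_2)
    also have "\<dots> = 0" using that by (metis add.right_inverse)
    finally show ?thesis using assms(1) by simp
  qed
  moreover have "- a = a" "- b = b" "- c = c" "- d = d" using * unfolding g mneg.simps m2.inject by blast+
  ultimately have "a = 0" "b = 0" "c = 0" "d = 0" by blast+
  then show False using assms(2) g by simp
qed

lemma act_mone [simp]: "act mone x = x"
  by (cases x) (simp_all add: mone_def)

lemma act_mneg [simp]: "act (mneg g) x = act g x"
proof -
  obtain a b c d where g: "g = Mat2 a b c d" by (cases g)
  show ?thesis
  proof (cases x)
    case None
    then show ?thesis using g by simp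
  next
    case (Some y)
    have 1: "(- c) * y + (- d) = - (c * y + d)" "(- a) * y + (- b) = - (a * y + b)" by simp_all
    show ?thesis unfolding g Some mneg.simps act.simps 1 neg_equal_0_iff_equal minus_divide_divide ..
  qed
qed

text \<open>Since both determinants are 1, no fraction 0/0 arises; it remains to separate the cases
  in which \<open>act h x\<close> is infinity.\<close>

lemma act_mmul:
  assumes "mdet g = 1" "mdet h = 1"
  shows "act (g \<odot> h) x = act g (act h x)"
proof -
  obtain a b c d where g: "g = Mat2 a b c d" by (cases g)
  obtain a' b' c' d' where h: "h = Mat2 a' b' c' d'" by (cases h)
  have gd: "a * d - b * c = 1" and hd: "a' * d' - b' * c' = 1" using assms g h by auto
  show ?thesis
  proof (cases x)
    case None
    show ?thesis
    proof (cases "c' = 0")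
      case True
      then have "a' \<noteq> 0" using hd by auto
      then show ?thesis using None g h True by simp
    next
      case False
      have 1: "a * a' + b * c' = (a * (a' / c') + b) * c'" "c * a' + d * c' = (c * (a' / c') + d) * c'"
        using False by (simp_all add: distrib_right)
      show ?thesis using False unfolding None g h mmul.simps act.simps 1 by simp
    qed
  next
    case (Some y)
    show ?thesis
    proof (cases "c' * y + d' = 0")
      case True
      have nz: "a' * y + b' \<noteq> 0"
      proof
        assume "a' * y + b' = 0"
        moreover have "a' * (c' * y + d') - c' * (a' * y + b') = 1" using hd by (simp add: algebra_simps)
        ultimately show False using True by simp
      qed
      have "(a * a' + b * c') * y + (a * b' + b * d') = a * (a' * y + b') + b * (c' * y + d')"
           "(c * a' + d * c') * y + (c * b' + d * d') = c * (a' * y + b') + d * (c' * y + d')"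
        by (simp_all add: algebra_simps)
      then show ?thesis using Some g h True nz by simp
    next
      case False
      have 1: "(a * a' + b * c') * y + (a * b' + b * d') = (a * ((a' * y + b') / (c' * y + d')) + b) * (c' * y + d')"
           "(c * a' + d * c') * y + (c * b' + d * d') = (c * ((a' * y + b') / (c' * y + d')) + d) * (c' * y + d')"
        using False by (simp_all add: distrib_right) (simp_all add: algebra_simps)
      show ?thesis using False unfolding Some g h mmul.simps act.simps 1 by simp
    qed
  qed
qed

section \<open>Fixed points on the projective line\<close>

lemma act_eq_iff:
  assumes "mdet (Mat2 a b c d) = 1"
  shows "act (Mat2 a b c d) None = None \<longleftrightarrow> c = 0"
    and "act (Mat2 a b c d) (Some x) = Some x \<longleftrightarrow> c * x * x + (d - a) * x - b = 0"
proof -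
  show "act (Mat2 a b c d) None = None \<longleftrightarrow> c = 0" by simp
  have *: "c * x * x + (d - a) * x - b = x * (c * x + d) - (a * x + b)" by (simp add: algebra_simps)
  show "act (Mat2 a b c d) (Some x) = Some x \<longleftrightarrow> c * x * x + (d - a) * x - b = 0"
  proof (cases "c * x + d = 0")
    case True
    \<comment> \<open>Determinant 1 forbids numerator and denominator to vanish together, so a pole
      is not a root of the quadratic either.\<close>
    have "a * x + b \<noteq> 0"
    proof
      assume "a * x + b = 0"
      moreover have "a * (c * x + d) - c * (a * x + b) = 1" using assms by (simp add: algebra_simps)
      ultimately show False using True by simp
    qed
    then show ?thesis unfolding * act.simps using True by (simp add: add_eq_0_iff)
  next
    case False
    then show ?thesis unfolding * by (auto simp: divide_simps)
  qed
qed

text \<open>With \<open>s\<close> a square root of the discriminant, completing the square factors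
  4p times the quadratic as (2px + q - s)(2px + q + s).\<close>

lemma card_quadratic_roots:
  fixes p q r s :: "'a::field"
  assumes two: "(2::'a) \<noteq> 0" and p: "p \<noteq> 0" and s: "s * s = q * q - 4 * p * r"
  shows "card {x. p * x * x + q * x + r = 0} = (if s = 0 then 1 else 2)"
proof -
  have "p * x * x + q * x + r = 0 \<longleftrightarrow> x = (s - q) / (2 * p) \<or> x = (- s - q) / (2 * p)" for x
  proof -
    have 4: "(4::'a) \<noteq> 0"
    proof -
      have "(4::'a) = 2 * 2" by simp
      then show ?thesis using two by (metis mult_eq_0_iff)
    qed
    have "4 * p * (p * x * x + q * x + r) = (2 * p * x + q) * (2 * p * x + q) - (q * q - 4 * p * r)"
      by (simp add: algebra_simps)
    also have "\<dots> = (2 * p * x + q - s) * (2 * p * x + q + s)"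
      unfolding s[symmetric] by (simp add: algebra_simps)
    finally have "p * x * x + q * x + r = 0 \<longleftrightarrow> 2 * p * x + q - s = 0 \<or> 2 * p * x + q + s = 0"
      using 4 p by (metis mult_eq_0_iff)
    moreover have "2 * p * x + q - s = 0 \<longleftrightarrow> x = (s - q) / (2 * p)"
      using two p by (auto simp: field_simps)
    moreover have "2 * p * x + q + s = 0 \<longleftrightarrow> x = (- s - q) / (2 * p)"
      using two p by (auto simp: field_simps eq_neg_iff_add_eq_0)
    ultimately show ?thesis by simp
  qed
  then have eq: "{x. p * x * x + q * x + r = 0} = {(s - q) / (2 * p), (- s - q) / (2 * p)}" by auto
  show ?thesis
  proof (cases "s = 0")
    case True
    then show ?thesis unfolding eq by simp
  next
    case False
    have "(s - q) / (2 * p) \<noteq> (- s - q) / (2 * p)"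
    proof
      assume "(s - q) / (2 * p) = (- s - q) / (2 * p)"
      then have "s - q = - s - q" using two p by (simp add: divide_cancel_right)
      then have "s + s = 0" by (metis diff_add_cancel add.right_inverse)
      then have "2 * s = 0" by (simp only: mult_2)
      then show False using False two by simp
    qed
    then show ?thesis unfolding eq using False by simp
  qed
qed

text \<open>The finite fixed points are the roots of a polynomial with discriminant tr^2 - 4. If c =
  0 its degree drops, and infinity takes the place of the missing root.\<close>

lemma card_fixpoints:
  fixes g :: "'a::field m2"
  assumes two: "(2::'a) \<noteq> 0" and sq: "\<And>x::'a. \<exists>r. r * r = x"
    and det: "mdet g = 1" and ns: "g \<noteq> mone" "g \<noteq> mneg mone"
  shows "card {x. act g x = x} = (if mtr g * mtr g = 4 then 1 else 2)"
proof -
  obtain a b c d where g: "g = Mat2 a b c d" by (cases g)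
  have d1: "a * d - b * c = 1" using det g by simp
  obtain s where s: "s * s = mtr g * mtr g - 4" using sq by blast
  have s0: "s = 0 \<longleftrightarrow> mtr g * mtr g = 4" using s by (metis mult_eq_0_iff eq_iff_diff_eq_0)
  have s': "s * s = (d - a) * (d - a) - 4 * c * (- b)"
  proof -
    have "s * s = (a + d) * (a + d) - 4 * (a * d - b * c)" using s g d1 by simp
    then show ?thesis by (simp add: algebra_simps)
  qed
  have quad: "act g (Some x) = Some x \<longleftrightarrow> c * x * x + (d - a) * x + (- b) = 0" for x
    using act_eq_iff(2)[of a b c d x] det g by simp
  have set: "{x. act g x = x} = (if c = 0 then {None} else {}) \<union> Some ` {x. c * x * x + (d - a) * x + (- b) = 0}"
  proof (rule Set.set_eqI)
    fix x show "x \<in> {x. act g x = x} \<longleftrightarrow> x \<in> (if c = 0 then {None} else {}) \<union> Some ` {x. c * x * x + (d - a) * x + (- b) = 0}"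
      using quad g by (cases x) auto
  qed
  show ?thesis
  proof (cases "c = 0")
    case False
    then show ?thesis unfolding set using card_quadratic_roots[OF two False s'] s0
      by (simp add: card_image)
  next
    case c0: True
    have ad: "a * d = 1" using d1 c0 by simp
    show ?thesis
    proof (cases "s = 0")
      case True
      then have "d = a" using s' c0 by simp
      then have "a * a = 1" using ad by simp
      then have "(a - 1) * (a + 1) = 0" by (simp add: algebra_simps)
      then have "a = 1 \<or> a = - 1" by (auto simp: eq_neg_iff_add_eq_0)
      then have "b \<noteq> 0" using ns g \<open>d = a\<close> c0 by (auto simp: mone_def)
      then have "{x. c * x * x + (d - a) * x + (- b) = 0} = {}" using c0 \<open>d = a\<close> by auto
      then show ?thesis unfolding set using c0 True s0 by simp
    next
      case False
      then have "d - a \<noteq> 0" using s' c0 by auto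
      then have "{x. c * x * x + (d - a) * x + (- b) = 0} = {b / (d - a)}" using c0
        by (auto simp: field_simps)
      then show ?thesis unfolding set using c0 False s0 by simp
    qed
  qed
qed

section \<open>Orbits and stabilizers of a finite subgroup of SL(2) containing -1\<close>

lemma card_eq_card_image_times:
  assumes "finite S" "\<And>x. x \<in> S \<Longrightarrow> card {z \<in> S. f z = f x} = k"
  shows "card S = card (f ` S) * k"
proof -
  have "card S = (\<Sum>x\<in>S. 1)" by simp
  also have "\<dots> = (\<Sum>y\<in>f ` S. \<Sum>x\<in>{x \<in> S. f x = y}. 1)" by (rule sum.image_gen[OF assms(1)])
  also have "\<dots> = (\<Sum>y\<in>f ` S. k)" by (rule sum.cong) (use assms(2) in auto)
  finally show ?thesis by simp
qed

text \<open>With -1 in \<open>G\<close>, the elements acting trivially are exactly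
  \<open>mone\<close> and \<open>mneg mone\<close>. By \<open>two\<close> and \<open>sq\<close>
  every quadratic splits, so fixed points can be counted exactly.\<close>

locale finite_sl2 =
  fixes G :: "'a::field m2 set"
  assumes fin: "finite G"
    and one: "mone \<in> G"
    and mul: "g \<in> G \<Longrightarrow> h \<in> G \<Longrightarrow> g \<odot> h \<in> G"
    and inv: "g \<in> G \<Longrightarrow> minv g \<in> G"
    and det: "g \<in> G \<Longrightarrow> mdet g = 1"
    and neg: "g \<in> G \<Longrightarrow> mneg g \<in> G"
    and two: "(2::'a) \<noteq> 0"
    and sq: "\<exists>r. r * r = (x::'a)"
begin

definition stab :: "'a option \<Rightarrow> 'a m2 set" where
  "stab x = {g \<in> G. act g x = x}"

text \<open>Trace 2 and determinant 1 give the characteristic polynomial (X - 1)^2, so these are the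
  unipotent elements fixing \<open>x\<close>, including the identity.\<close>

definition unip :: "'a option \<Rightarrow> 'a m2 set" where
  "unip x = {g \<in> stab x. mtr g = 2}"

definition orb :: "'a option \<Rightarrow> 'a option set" where
  "orb x = (\<lambda>g. act g x) ` G"

text \<open>Every stabilizer contains 1 and -1; these are the points at which it is larger.\<close>

definition sing :: "'a option set" where
  "sing = {x. \<exists>g\<in>G - {mone, mneg mone}. act g x = x}"

lemma four: "(4::'a) \<noteq> 0"
proof -
  have "(4::'a) = 2 * 2" by simp
  then show ?thesis using two by (metis mult_eq_0_iff)
qed

lemma two_neq_minus_two: "(2::'a) \<noteq> - 2"
  using four by (simp add: eq_neg_iff_add_eq_0)

lemma finite_stab [simp]: "finite (stab x)" and finite_unip [simp]: "finite (unip x)"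
  and finite_orb [simp]: "finite (orb x)"
  using fin by (auto simp: stab_def unip_def orb_def)

lemma act_mul: "g \<in> G \<Longrightarrow> h \<in> G \<Longrightarrow> act (g \<odot> h) x = act g (act h x)"
  by (simp add: act_mmul det)

lemma act_inv [simp]: "g \<in> G \<Longrightarrow> act (minv g) (act g x) = x"
  using act_mul[of "minv g" g x] inv det by simp

lemma mmul_left_cancel: "g \<in> G \<Longrightarrow> g \<odot> h = g \<odot> k \<Longrightarrow> h = k"
  by (metis mmul_assoc minv_mmul(1) mmul_mone(1) det)

lemma mmul_right_cancel: "g \<in> G \<Longrightarrow> h \<odot> g = k \<odot> g \<Longrightarrow> h = k"
  by (metis mmul_assoc minv_mmul(2) mmul_mone(2) det)

text \<open>The fibres of the orbit map g -> \<open>act g x\<close> are the left cosets of the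
  stabilizer.\<close>

lemma card_orb_stab: "card G = card (orb x) * card (stab x)"
  unfolding orb_def
proof (rule card_eq_card_image_times[OF fin])
  fix g assume g: "g \<in> G"
  have "{z \<in> G. act z x = act g x} = (\<lambda>h. g \<odot> h) ` stab x"
  proof (intro Set.set_eqI iffI)
    fix z assume z: "z \<in> {z \<in> G. act z x = act g x}"
    then have "act (minv g \<odot> z) x = x" using g inv by (simp add: act_mul)
    then have "minv g \<odot> z \<in> stab x" using z g inv mul by (simp add: stab_def)
    moreover have "z = g \<odot> (minv g \<odot> z)" using g det by (simp flip: mmul_assoc)
    ultimately show "z \<in> (\<lambda>h. g \<odot> h) ` stab x" by blast
  qed (use g mul act_mul in \<open>auto simp: stab_def\<close>)
  moreover have "inj_on (\<lambda>h. g \<odot> h) (stab x)"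
    using mmul_left_cancel[OF g] by (auto intro: inj_onI)
  ultimately show "card {z \<in> G. act z x = act g x} = card (stab x)"
    by (simp add: card_image)
qed

lemma conj_stab:
  assumes g: "g \<in> G" and h: "h \<in> stab x"
  shows "g \<odot> h \<odot> minv g \<in> stab (act g x)" "mtr (g \<odot> h \<odot> minv g) = mtr h"
proof -
  show "g \<odot> h \<odot> minv g \<in> stab (act g x)"
    using assms mul inv by (simp add: stab_def act_mul)
  show "mtr (g \<odot> h \<odot> minv g) = mtr h"
    using g det by (metis mtr_commute mmul_assoc minv_mmul(1) mmul_mone(1))
qed

lemma inj_conj: "g \<in> G \<Longrightarrow> inj_on (\<lambda>h. g \<odot> h \<odot> minv g) A"
  using mmul_left_cancel mmul_right_cancel inv by (blast intro: inj_onI)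

text \<open>Conjugation by \<open>g\<close> is injective and preserves traces, which gives one
  inequality; the other one is the same for the inverse of \<open>g\<close>.\<close>

lemma card_stab_act [simp]:
  assumes "g \<in> G" shows "card (stab (act g x)) = card (stab x)" "card (unip (act g x)) = card (unip x)"
proof -
  have le: "card (stab y) \<le> card (stab (act k y)) \<and> card (unip y) \<le> card (unip (act k y))" if k: "k \<in> G" for k y
    using conj_stab[OF k]
    by (auto intro!: card_inj_on_le[OF inj_conj[OF k]] simp: unip_def)
  show "card (stab (act g x)) = card (stab x)" "card (unip (act g x)) = card (unip x)"
    using le[OF assms, of x] le[OF inv[OF assms], of "act g x"] assms by auto
qed

lemma orb_self: "x \<in> orb x"
  unfolding orb_def using one by (rule rev_image_eqI) simp

lemma card_orb_cong:
  assumes "y \<in> orb x" shows "card (stab y) = card (stab x)" "card (unip y) = card (unip x)"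
  using assms by (auto simp: orb_def)

lemma orb_eq:
  assumes "y \<in> orb x" shows "orb y = orb x"
proof -
  obtain g where g: "g \<in> G" "y = act g x" using assms by (auto simp: orb_def)
  show ?thesis
  proof (intro Set.set_eqI iffI)
    fix z assume "z \<in> orb y"
    then obtain h where "h \<in> G" "z = act h y" by (auto simp: orb_def)
    then show "z \<in> orb x" using g mul by (auto simp: orb_def act_mul intro!: image_eqI[of _ _ "h \<odot> g"])
  next
    fix z assume "z \<in> orb x"
    then obtain h where "h \<in> G" "z = act h x" by (auto simp: orb_def)
    then show "z \<in> orb y" using g mul inv
      by (auto simp: orb_def act_mul intro!: image_eqI[of _ _ "h \<odot> minv g"])
  qed
qed

lemma orb_disjoint: "y \<notin> orb x \<Longrightarrow> orb x \<inter> orb y = {}"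
  using orb_eq orb_self by blast

lemma minus_one: "mneg mone \<in> G" "mneg mone \<noteq> (mone :: 'a m2)"
proof -
  show "mneg mone \<in> G" using neg one .
  show "mneg mone \<noteq> (mone :: 'a m2)" using mneg_neq[OF two det[OF one]] .
qed

lemma one_stab: "mone \<in> stab x" "mneg mone \<in> stab x" "mone \<in> unip x" "mneg mone \<notin> unip x"
  using one minus_one two_neq_minus_two by (auto simp: stab_def unip_def) (auto simp: mone_def)

lemma stab_neg: "g \<in> stab x \<Longrightarrow> mneg g \<in> stab x"
  using neg by (simp add: stab_def)

lemma card_fix: "g \<in> G - {mone, mneg mone} \<Longrightarrow> card {x. act g x = x} = (if mtr g * mtr g = 4 then 1 else 2)"
  using card_fixpoints[OF two sq, of g] det by auto

section \<open>Counting fixed points, and the arithmetic of orbit sizes\<close>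

lemma finite_sing: "finite sing"
proof -
  \<comment> \<open>The cardinality is 1 or 2, whereas an infinite set has \<open>card\<close> equal
    to 0.\<close>
  have "finite {x. act g x = x}" if "g \<in> G - {mone, mneg mone}" for g
    using card_fix[OF that] by (metis card.infinite zero_neq_numeral zero_neq_one)
  moreover have "sing = (\<Union>g\<in>G - {mone, mneg mone}. {x. act g x = x})"
    by (auto simp: sing_def)
  ultimately show ?thesis using fin by auto
qed

lemma mtr_sq: "mtr g * mtr g = (4::'a) \<longleftrightarrow> mtr g = 2 \<or> mtr g = - 2"
proof -
  have "mtr g * mtr g - 4 = (mtr g - 2) * (mtr g + 2)" by (simp add: algebra_simps)
  then show ?thesis by (metis eq_iff_diff_eq_0 mult_eq_0_iff eq_neg_iff_add_eq_0)
qed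

text \<open>Elements of trace -2 are the negatives of unipotent ones, so each nontrivial element of
  \<open>unip x\<close> accounts for two elements. Integers avoid truncated subtraction.\<close>

lemma card_parabolic:
  "int (card {g \<in> G - {mone, mneg mone}. act g x = x \<and> mtr g * mtr g = 4}) = 2 * int (card (unip x)) - 2"
proof -
  let ?U = "unip x - {mone}"
  have "{g \<in> G - {mone, mneg mone}. act g x = x \<and> mtr g * mtr g = 4} = ?U \<union> mneg ` ?U"
  proof (intro Set.set_eqI iffI)
    fix g assume g: "g \<in> {g \<in> G - {mone, mneg mone}. act g x = x \<and> mtr g * mtr g = 4}"
    show "g \<in> ?U \<union> mneg ` ?U"
    proof (cases "mtr g = 2")
      case False
      then have "mneg g \<in> ?U" using g mtr_sq[of g] neg by (auto simp: unip_def stab_def) (metis mneg_mneg)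
      then show ?thesis by (metis UnI2 mneg_mneg rev_image_eqI)
    qed (use g in \<open>auto simp: unip_def stab_def\<close>)
  next
    fix g assume "g \<in> ?U \<union> mneg ` ?U"
    then obtain h where h: "h \<in> ?U" "g = h \<or> g = mneg h" by blast
    then have "h \<in> G" "h \<noteq> mone" "h \<noteq> mneg mone" "act h x = x" "mtr h = 2"
      using one_stab(4)[of x] by (auto simp: unip_def stab_def)
    moreover have "mneg h \<noteq> mone" "mneg h \<noteq> mneg mone"
      using \<open>h \<noteq> mneg mone\<close> \<open>h \<noteq> mone\<close> by (metis mneg_mneg)+
    ultimately show "g \<in> {g \<in> G - {mone, mneg mone}. act g x = x \<and> mtr g * mtr g = 4}"
      using h(2) neg mtr_sq[of g] by auto
  qed
  moreover have "?U \<inter> mneg ` ?U = {}"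
    using two_neq_minus_two by (auto simp: unip_def)
  moreover have "card (mneg ` ?U) = card ?U"
    by (rule card_image) (metis inj_onI mneg_mneg)
  moreover have "card ?U + 1 = card (unip x)"
    using one_stab(3)[of x] by (metis Suc_eq_plus1 card.remove finite_unip)
  ultimately show ?thesis by (simp add: card_Un_disjoint)
qed

lemma card_nonscalar_stab:
  "int (card {g \<in> G - {mone, mneg mone}. act g x = x}) = int (card (stab x)) - 2"
proof -
  have "{g \<in> G - {mone, mneg mone}. act g x = x} = stab x - {mone, mneg mone}"
    by (auto simp: stab_def)
  moreover have "card {mone, mneg mone :: 'a m2} = 2" using minus_one(2) by (simp add: eq_commute)
  moreover have "{mone, mneg mone} \<subseteq> stab x" using one_stab by auto
  moreover have "2 \<le> card (stab x)" using calculation card_mono[OF finite_stab] by metis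
  ultimately show ?thesis
    by (simp add: card_Diff_subset)
qed

text \<open>Riemann-Hurwitz for the action on the projective line, obtained by counting fixed points twice:
  a nonscalar element has two fixed points, which coincide if its trace is 2 or -2.\<close>

lemma sum_sing: "(\<Sum>x\<in>sing. int (card (stab x)) + 2 * int (card (unip x)) - 4) = 2 * int (card G) - 4"
proof -
  let ?H = "G - {mone, mneg mone}"
  have fH: "finite ?H" using fin by simp
  have "2 * int (card ?H) = (\<Sum>g\<in>?H. 2)" by simp
  \<comment> \<open>The second indicator counts the only fixed point of a parabolic element once
    more, so that every nonscalar element contributes exactly 2.\<close>
  also have "\<dots> = (\<Sum>g\<in>?H. \<Sum>x\<in>sing. of_bool (act g x = x) + of_bool (act g x = x \<and> mtr g * mtr g = 4))"
  proof (rule sum.cong[OF refl])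
    fix g assume g: "g \<in> ?H"
    have "{x \<in> sing. act g x = x} = {x. act g x = x}" using g by (auto simp: sing_def)
    then have "(\<Sum>x\<in>sing. of_bool (act g x = x)) = int (card {x. act g x = x})"
      using finite_sing by (simp add: sum.If_cases Int_def of_bool_def)
    moreover have "(\<Sum>x\<in>sing. of_bool (act g x = x \<and> mtr g * mtr g = 4)) =
        (if mtr g * mtr g = 4 then \<Sum>x\<in>sing. of_bool (act g x = x) else (0::int))" by simp
    ultimately show "2 = (\<Sum>x\<in>sing. of_bool (act g x = x) + of_bool (act g x = x \<and> mtr g * mtr g = 4) :: int)"
      using card_fix[OF g] by (simp add: sum.distrib)
  qed
  also have "\<dots> = (\<Sum>x\<in>sing. \<Sum>g\<in>?H. of_bool (act g x = x) + of_bool (act g x = x \<and> mtr g * mtr g = 4))"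
    by (rule sum.swap)
  also have "\<dots> = (\<Sum>x\<in>sing. int (card (stab x)) + 2 * int (card (unip x)) - 4)"
  proof (rule sum.cong[OF refl])
    fix x
    have "(\<Sum>g\<in>?H. of_bool (P g)) = int (card {g \<in> ?H. P g})" for P
      using fH by (simp add: sum.If_cases Int_def of_bool_def)
    then show "(\<Sum>g\<in>?H. of_bool (act g x = x) + of_bool (act g x = x \<and> mtr g * mtr g = 4)) =
        int (card (stab x)) + 2 * int (card (unip x)) - 4"
      using card_parabolic[of x] card_nonscalar_stab[of x] by (simp add: sum.distrib)
  qed
  finally have "(\<Sum>x\<in>sing. int (card (stab x)) + 2 * int (card (unip x)) - 4) = 2 * int (card ?H)" by simp
  moreover have "int (card ?H) = int (card G) - 2"
  proof -
    have "card {mone, mneg mone :: 'a m2} = 2" using minus_one(2) by (simp add: eq_commute)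
    moreover have "{mone, mneg mone} \<subseteq> G" using one minus_one by auto
    moreover have "2 \<le> card G" using calculation card_mono[OF fin] by metis
    ultimately show ?thesis by (simp add: card_Diff_subset)
  qed
  ultimately show ?thesis by simp
qed

end

text \<open>In the application \<open>q\<close> + 2 is |U|, \<open>f\<close> is the number of cosets
  of U in the affine part of the orbit of infinity, and \<open>e\<close> and \<open>k\<close> come
  from stabilizers. The equation makes 1 + fq a divisor of 2ef; it is prime to f, so it divides 2e,
  which is at most 2q + 2. For f = 2 it is odd and must divide e, which is too small.\<close>

lemma orbit_size_arith:
  fixes f q e k :: nat
  assumes "f \<ge> 1" "q \<ge> 1" "e \<ge> 1" "e \<le> q + 1" and eq: "(1 + f * q) * k = (1 + f * (q + 2)) * e"
  shows "f = 1 \<or> q = 1 \<and> f = 3"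
proof -
  have "(1 + f * q) * k = (1 + f * q) * e + f * (2 * e)" using eq by (simp add: algebra_simps)
  then have "(1 + f * q) dvd f * (2 * e)" by (metis dvd_add_right_iff dvd_triv_left)
  moreover have "coprime (1 + f * q) f"
    by (rule coprimeI) (metis dvd_add_left_iff dvd_mult2)
  ultimately have dvd: "(1 + f * q) dvd 2 * e" by (simp only: coprime_dvd_mult_right_iff)
  then have le: "1 + f * q \<le> 2 * q + 2" using assms(3,4) dvd_imp_le[OF dvd] by linarith
  consider "f = 1" | "f = 2" | "f \<ge> 3" using assms(1) by linarith
  then show ?thesis
  proof cases
    case 2
    have "coprime (1 + f * q) 2" using 2 by simp
    then have "(1 + f * q) dvd e" using dvd by (simp only: coprime_dvd_mult_right_iff)
    then have "1 + f * q \<le> e" using assms(3) by (auto dest: dvd_imp_le)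
    then show ?thesis using assms 2 by simp
  next
    case 3
    then have "3 * q \<le> f * q" by simp
    then have "q = 1" using le assms(2) by linarith
    then show ?thesis using le 3 by simp
  qed simp
qed

text \<open>\<open>A\<close> is a union of cosets of the subgroup \<open>U\<close>, and the fibre of
  a -> a + U through \<open>a\<close> is the coset of \<open>a\<close>.\<close>

lemma card_coset_union:
  fixes U A :: "'a::ab_group_add set"
  assumes "finite A" and "0 \<in> U" "\<And>x y. x \<in> U \<Longrightarrow> y \<in> U \<Longrightarrow> x + y \<in> U" "\<And>x. x \<in> U \<Longrightarrow> - x \<in> U"
    and "\<And>a u. a \<in> A \<Longrightarrow> u \<in> U \<Longrightarrow> a + u \<in> A"
  shows "card U dvd card A"
proof -
  have "card A = card ((\<lambda>a. (+) a ` U) ` A) * card U"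
  proof (rule card_eq_card_image_times[OF assms(1)])
    fix a assume a: "a \<in> A"
    have "{z \<in> A. (+) z ` U = (+) a ` U} = (+) a ` U"
    proof (intro Set.set_eqI iffI)
      fix z assume "z \<in> {z \<in> A. (+) z ` U = (+) a ` U}"
      then have "z + 0 \<in> (+) a ` U" using assms(2) by blast
      then show "z \<in> (+) a ` U" by simp
    next
      fix z assume "z \<in> (+) a ` U"
      then obtain u where u: "u \<in> U" "z = a + u" by auto
      have "(+) z ` U = (+) a ` U"
      proof (intro Set.set_eqI iffI)
        fix w assume "w \<in> (+) z ` U"
        then obtain v where "v \<in> U" "w = z + v" by auto
        then show "w \<in> (+) a ` U" using u assms(3) by (auto simp: add.assoc)
      next
        fix w assume "w \<in> (+) a ` U"
        then obtain v where "v \<in> U" "w = a + v" by auto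
        then have "w = z + (- u + v)" using u by (simp add: algebra_simps)
        moreover have "- u + v \<in> U" using \<open>v \<in> U\<close> u assms(3,4) by blast
        ultimately show "w \<in> (+) z ` U" by blast
      qed
      then show "z \<in> {z \<in> A. (+) z ` U = (+) a ` U}" using u a assms(5) by simp
    qed
    then show "card {z \<in> A. (+) z ` U = (+) a ` U} = card U" by (simp add: card_image)
  qed
  then show ?thesis by simp
qed

section \<open>Unipotent elements fixing infinity and zero\<close>

locale finite_sl2_pair = finite_sl2 +
  fixes \<delta> :: 'a
  assumes upper_1: "upper 1 \<in> G" and lower_delta: "lower \<delta> \<in> G" and delta: "\<delta> \<noteq> 0"
begin

text \<open>\<open>U\<close> and \<open>L\<close> are the root subgroups of \<open>G\<close> at
  infinity and at 0, written additively.\<close>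

definition U :: "'a set" where "U = {a. upper a \<in> G}"
definition L :: "'a set" where "L = {b. lower b \<in> G}"

lemma upper_ops: "upper a \<odot> upper b = upper (a + b)" "minv (upper a) = upper (- a)" "upper 0 = mone"
  by (simp_all add: upper_def mone_def add.commute)

lemma lower_ops: "lower a \<odot> lower b = lower (a + b)" "minv (lower a) = lower (- a)" "lower 0 = mone"
  by (simp_all add: lower_def mone_def add.commute)

lemma U_group: "0 \<in> U" "x \<in> U \<Longrightarrow> y \<in> U \<Longrightarrow> x + y \<in> U" "x \<in> U \<Longrightarrow> - x \<in> U" "1 \<in> U"
  using one upper_1 by (auto simp: U_def upper_ops simp flip: upper_ops dest: mul inv)

lemma L_group: "0 \<in> L" "x \<in> L \<Longrightarrow> y \<in> L \<Longrightarrow> x + y \<in> L" "x \<in> L \<Longrightarrow> - x \<in> L" "\<delta> \<in> L"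
  using one lower_delta by (auto simp: L_def lower_ops simp flip: lower_ops dest: mul inv)

text \<open>Fixing infinity means c = 0; then ad = 1 and a + d = 2 give (a - 1)^2 = 0.\<close>

lemma unip_inf: "unip None = upper ` U"
proof (intro Set.set_eqI iffI)
  fix g assume g: "g \<in> unip None"
  obtain a b c d where g': "g = Mat2 a b c d" by (cases g)
  have "c = 0" "a * d = 1" "d = 2 - a" using g g' det[of g] by (auto simp: unip_def stab_def algebra_simps split: if_splits)
  then have "(a - 1) * (a - 1) = 0" by (simp add: algebra_simps)
  then have "a = 1" by simp
  then have "g = upper b" using \<open>c = 0\<close> \<open>d = 2 - a\<close> g' by (simp add: upper_def)
  then show "g \<in> upper ` U" using g by (auto simp: U_def unip_def stab_def)
qed (auto simp: U_def unip_def stab_def upper_def)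

lemma unip_zero: "unip (Some 0) = lower ` L"
proof (intro Set.set_eqI iffI)
  fix g assume g: "g \<in> unip (Some 0)"
  obtain a b c d where g': "g = Mat2 a b c d" by (cases g)
  have "b = 0" "a * d = 1" "d = 2 - a" using g g' det[of g] by (auto simp: unip_def stab_def algebra_simps split: if_splits)
  then have "(a - 1) * (a - 1) = 0" by (simp add: algebra_simps)
  then have "a = 1" by simp
  then have "g = lower c" using \<open>b = 0\<close> \<open>d = 2 - a\<close> g' by (simp add: lower_def)
  then show "g \<in> lower ` L" using g by (auto simp: L_def unip_def stab_def)
qed (auto simp: L_def unip_def stab_def lower_def)

lemma card_U: "card (unip None) = card U" and card_L: "card (unip (Some 0)) = card L"
  unfolding unip_inf unip_zero by (rule card_image; auto intro: inj_onI simp: upper_def lower_def)+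

lemma finite_U: "finite U" and finite_L: "finite L"
proof -
  have "finite (upper ` U)" "finite (lower ` L)" by (auto simp flip: unip_inf unip_zero)
  then show "finite U" "finite L"
    by (auto elim!: finite_imageD intro!: inj_onI simp: upper_def lower_def)
qed

lemma units_distinct: "(0::'a) \<noteq> 1" "(0::'a) \<noteq> - 1" "(1::'a) \<noteq> - 1"
  using two by (auto simp: eq_neg_iff_add_eq_0)

lemma card_U_ge: "card U \<ge> 3"
proof -
  have "card {0, 1, - 1 :: 'a} \<le> card U" using U_group finite_U by (intro card_mono) auto
  then show ?thesis using units_distinct by simp
qed

lemma card_L_ge: "card L \<ge> 2"
proof -
  have "card {0, \<delta>} \<le> card L" using L_group finite_L by (intro card_mono) auto
  then show ?thesis using delta by simp
qed

section \<open>Points fixed by nontrivial unipotents form one orbit\<close>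

lemma singI:
  assumes "card (stab x) > 2 \<or> card (unip x) \<ge> 2" shows "x \<in> sing"
proof (rule ccontr)
  assume *: "x \<notin> sing"
  then have s: "stab x \<subseteq> {mone, mneg mone}" by (auto simp: sing_def stab_def)
  then have "card (stab x) \<le> 2" by (metis card_2_iff card_mono finite.emptyI finite_insert minus_one(2))
  moreover have "unip x \<subseteq> {mone}" using s one_stab(4)[of x] by (auto simp: unip_def)
  then have "card (unip x) \<le> 1" by (metis card.empty card_insert_disjoint card_mono empty_iff finite.emptyI finite_insert One_nat_def)
  ultimately show False using assms by linarith
qed

lemma stab_ge: "card (stab x) \<ge> 2" "card (unip x) \<ge> 1"
proof -
  have "card {mone, mneg mone :: 'a m2} \<le> card (stab x)" using one_stab by (intro card_mono) auto
  then show "card (stab x) \<ge> 2" using minus_one(2) by (simp add: eq_commute)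
  show "card (unip x) \<ge> 1" using one_stab(3)[of x] by (metis One_nat_def Suc_leI card_gt_0_iff empty_iff finite_unip)
qed

text \<open>The elements g and -g are distinct and act in the same way, so the stabilizer splits
  into pairs.\<close>

lemma even_stab: "even (card (stab x))"
proof -
  have "card (stab x) = card ((\<lambda>g. {g, mneg g}) ` stab x) * 2"
  proof (rule card_eq_card_image_times[OF finite_stab])
    fix g assume g: "g \<in> stab x"
    then have "mneg g \<noteq> g" using mneg_neq[OF two det, of g] by (auto simp: stab_def)
    moreover have "{z \<in> stab x. {z, mneg z} = {g, mneg g}} = {g, mneg g}"
      using g stab_neg[OF g] by (auto simp: doubleton_eq_iff)
    ultimately show "card {z \<in> stab x. {z, mneg z} = {g, mneg g}} = 2" by (simp add: eq_commute)
  qed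
  then show ?thesis by simp
qed

text \<open>The contribution of a point to \<open>sum_sing\<close>; it is 0 if only 1 and -1 fix the
  point.\<close>

abbreviation weight :: "'a option \<Rightarrow> int" where
  "weight x \<equiv> int (card (stab x)) + 2 * int (card (unip x)) - 4"

lemma weight_nonneg: "weight x \<ge> 0"
  using stab_ge[of x] by linarith

lemma sum_orb: "sum weight (orb x) = int (card (orb x)) * weight x"
proof -
  have "sum weight (orb x) = (\<Sum>y\<in>orb x. weight x)"
    by (rule sum.cong) (use card_orb_cong[of _ x] in auto)
  then show ?thesis by simp
qed

lemma int_card_orb_stab: "int (card G) = int (card (orb x)) * int (card (stab x))"
  using card_orb_stab[of x] by (metis of_nat_mult)

lemma orb_sing: "x \<in> sing \<Longrightarrow> orb x \<subseteq> sing"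
proof
  fix y assume x: "x \<in> sing" and y: "y \<in> orb x"
  have "card (stab x) > 2 \<or> card (unip x) \<ge> 2"
  proof -
    obtain g where "g \<in> G" "g \<noteq> mone" "g \<noteq> mneg mone" "act g x = x" using x by (auto simp: sing_def)
    then have "{mone, mneg mone, g} \<subseteq> stab x" using one_stab by (auto simp: stab_def)
    then have "card {mone, mneg mone, g} \<le> card (stab x)" by (intro card_mono) auto
    then show ?thesis using \<open>g \<noteq> mone\<close> \<open>g \<noteq> mneg mone\<close> minus_one(2) by (simp add: eq_commute)
  qed
  then show "y \<in> sing" using singI[of y] card_orb_cong[OF y] by simp
qed

text \<open>Distinct orbits are disjoint and weights are nonnegative, so the total in
  \<open>sum_sing\<close> bounds the weight of any two orbits.\<close>

lemma sum_two_orbits: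
  assumes "x \<in> sing" "y \<in> sing" "y \<notin> orb x"
  shows "sum weight (orb x) + sum weight (orb y) \<le> 2 * int (card G) - 4"
proof -
  have "sum weight (orb x) + sum weight (orb y) = sum weight (orb x \<union> orb y)"
    using orb_disjoint[OF assms(3)] by (simp add: sum.union_disjoint)
  also have "\<dots> \<le> sum weight sing"
    using orb_sing assms weight_nonneg by (intro sum_mono2 finite_sing) auto
  finally show ?thesis using sum_sing by simp
qed

text \<open>A nontrivial unipotent raises the weight to at least the order of the stabilizer, and
  orbit size times stabilizer order is |G|.\<close>

lemma orb_weight_ge:
  assumes "card (unip x) \<ge> 2" shows "sum weight (orb x) \<ge> int (card G)"
proof -
  have "int (card (stab x)) \<le> weight x" using assms by linarith
  then show ?thesis unfolding sum_orb int_card_orb_stab[of x] by (intro mult_left_mono) auto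
qed

text \<open>A second orbit with nontrivial unipotents would bring the total weight to at least 2|G|,
  but it is only 2|G| - 4.\<close>

lemma unip_orb:
  assumes "card (unip x) \<ge> 2" shows "x \<in> orb None"
proof (rule ccontr)
  assume "x \<notin> orb None"
  moreover have "card (unip None) \<ge> 2" using card_U card_U_ge by simp
  ultimately show False
    using sum_two_orbits[of None x] orb_weight_ge[of x] orb_weight_ge[of None] singI assms by force
qed

lemma zero_orb: "Some 0 \<in> orb None"
  using unip_orb card_L card_L_ge by simp

lemma card_L_eq: "card L = card U"
  using card_orb_cong(2)[OF zero_orb] card_L card_U by simp

section \<open>The size of the orbit of infinity\<close>

lemma card_orb_inf_ge: "card (orb None) \<ge> 2"
proof -
  have "card {None, Some (0::'a)} \<le> card (orb None)" using zero_orb orb_self by (intro card_mono) auto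
  then show ?thesis by simp
qed

text \<open>The number \<open>e\<close> counts the squares a^2 of the upper left entries. The
  matrices g with a given a^2 form the cosets of \<open>U\<close> through one such g and its
  negative, 2|U| elements in all. Conjugating \<open>upper 1\<close> by g gives
  \<open>upper (a * a)\<close>, so the squares lie in U without 0.\<close>

lemma card_stab_inf: "\<exists>e. card (stab None) = 2 * card U * e \<and> 1 \<le> e \<and> e + 1 \<le> card U"
proof -
  define f :: "'a m2 \<Rightarrow> 'a" where "f g = (case g of Mat2 a b c d \<Rightarrow> a * a)" for g
  have stabD: "g \<in> stab None \<Longrightarrow> \<exists>a b d. g = Mat2 a b 0 d \<and> a * d = 1" for g
    using det[of g] by (cases g) (auto simp: stab_def split: if_splits)
  have "card (stab None) = card (f ` stab None) * (2 * card U)"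
  proof (rule card_eq_card_image_times[OF finite_stab])
    fix g assume g: "g \<in> stab None"
    then have gG: "g \<in> G" by (simp add: stab_def)
    obtain a b d where g': "g = Mat2 a b 0 d" and ad: "a * d = 1" using stabD[OF g] by blast
    let ?T = "(\<lambda>u. g \<odot> upper u) ` U"
    have "{z \<in> stab None. f z = f g} = ?T \<union> mneg ` ?T"
    proof (intro Set.set_eqI iffI)
      fix z assume z: "z \<in> {z \<in> stab None. f z = f g}"
      then obtain a' b' d' where z': "z = Mat2 a' b' 0 d'" and ad': "a' * d' = 1" using stabD by blast
      have "a' * a' = a * a" using z z' g' by (simp add: f_def)
      then have "(a' - a) * (a' + a) = 0" by (simp add: algebra_simps)
      then have cases: "a' = a \<or> a' = - a" by (auto simp: eq_neg_iff_add_eq_0)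
      have zG: "z \<in> G" using z by (simp add: stab_def)
      \<comment> \<open>Once the upper left entries agree, determinant 1 makes the lower right
        entries agree, and the quotient is unitriangular.\<close>
      have key: "w \<in> ?T" if w: "w \<in> G" "w = Mat2 a b'' 0 d''" for w b'' d''
      proof -
        have "a * d'' = 1" using det[OF w(1)] w(2) by simp
        then have "d'' = d" using ad by (metis mult_left_cancel mult_zero_left zero_neq_one)
        then have "minv g \<odot> w = upper (d * b'' - b * d)" using ad g' w by (simp add: upper_def mult.commute)
        moreover have "minv g \<odot> w \<in> G" using gG w mul inv by simp
        ultimately have "d * b'' - b * d \<in> U" by (simp add: U_def)
        moreover have "w = g \<odot> (minv g \<odot> w)" using gG det by (simp flip: mmul_assoc)
        ultimately show "w \<in> ?T" using \<open>minv g \<odot> w = upper (d * b'' - b * d)\<close> by auto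
      qed
      show "z \<in> ?T \<union> mneg ` ?T"
      proof (cases "a' = a")
        case True
        then show ?thesis using key[OF zG, of b' d'] z' by simp
      next
        case False
        then have "mneg z \<in> ?T" using key[OF neg[OF zG], of "- b'" "- d'"] z' cases by simp
        then show ?thesis by (metis UnI2 mneg_mneg rev_image_eqI)
      qed
    next
      fix z assume "z \<in> ?T \<union> mneg ` ?T"
      then obtain u where u: "u \<in> U" "z = g \<odot> upper u \<or> z = mneg (g \<odot> upper u)" by auto
      have "g \<odot> upper u \<in> G" using gG u mul by (simp add: U_def)
      then have "z \<in> G" using u(2) neg by auto
      moreover have "f z = f g" "act z None = None" using u(2) g' by (auto simp: f_def upper_def)
      ultimately show "z \<in> {z \<in> stab None. f z = f g}" by (simp add: stab_def)
    qed
    moreover have "?T \<inter> mneg ` ?T = {}"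
    proof -
      have "a \<noteq> - a"
      proof
        assume "a = - a"
        then have "2 * a = 0" by (metis add.right_inverse mult_2)
        then show False using two ad by auto
      qed
      then show ?thesis using g' by (auto simp: upper_def)
    qed
    moreover have "card ?T = card U"
      using ad g' by (intro card_image inj_onI) (auto simp: upper_def)
    moreover have "card (mneg ` ?T) = card ?T"
      by (rule card_image) (metis inj_onI mneg_mneg)
    ultimately show "card {z \<in> stab None. f z = f g} = 2 * card U"
      using finite_U by (simp add: card_Un_disjoint)
  qed
  moreover have "f ` stab None \<subseteq> U - {0}"
  proof
    fix y assume "y \<in> f ` stab None"
    then obtain g where g: "g \<in> stab None" "y = f g" by auto
    then obtain a b d where g': "g = Mat2 a b 0 d" and ad: "a * d = 1" using stabD by blast
    have "g \<odot> upper 1 \<odot> minv g = upper (a * a)" using g' ad by (simp add: upper_def algebra_simps)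
    moreover have "g \<odot> upper 1 \<odot> minv g \<in> G" using g mul inv upper_1 by (simp add: stab_def)
    ultimately show "y \<in> U - {0}" using g g' ad by (auto simp: U_def f_def)
  qed
  then have "card (f ` stab None) \<le> card U - 1"
    using card_mono[of "U - {0}"] finite_U U_group(1) by (metis card_Diff_singleton finite_Diff)
  moreover have "card (f ` stab None) \<ge> 1"
    using one_stab(1)[of None] by (metis One_nat_def Suc_leI card_gt_0_iff empty_iff finite_imageI finite_stab image_is_empty)
  ultimately show ?thesis using card_U_ge
    by (intro exI[of _ "card (f ` stab None)"]) (auto simp: mult.commute)
qed

lemma orb_inf_translate: "Some a \<in> orb None \<Longrightarrow> u \<in> U \<Longrightarrow> Some (a + u) \<in> orb None"
proof -
  assume a: "Some a \<in> orb None" and u: "u \<in> U"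
  then obtain g where "g \<in> G" "Some a = act g None" by (auto simp: orb_def)
  then have "Some (a + u) = act (upper u \<odot> g) None" using u
    by (simp add: act_mul U_def) (metis act.simps(2) upper_def add_cancel_left_left div_by_1 mult_1 mult_zero_left zero_neq_one)
  then show ?thesis using \<open>g \<in> G\<close> u mul by (auto simp: orb_def U_def)
qed

lemma orb_inf_eq: "orb None = insert None (Some ` {a. Some a \<in> orb None})"
  using orb_self[of None] by (auto) (metis mem_Collect_eq not_Some_eq rev_image_eqI)

lemma finite_affine_orb: "finite {a. Some a \<in> orb None}"
  using finite_vimageI[OF finite_orb, of Some None] by (simp add: vimage_def)

lemma card_orb_inf_affine: "card (orb None) = 1 + card {a. Some a \<in> orb None}"
  by (subst orb_inf_eq) (use finite_affine_orb in \<open>simp add: card_image\<close>)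

text \<open>Translations by \<open>U\<close> preserve the affine part of the orbit, which is thus a
  union of \<open>f\<close> cosets; it is nonempty as it contains 0.\<close>

lemma card_orb_inf_mod: "\<exists>f. card (orb None) = 1 + f * card U \<and> f \<ge> 1"
proof -
  have "card U dvd card {a. Some a \<in> orb None}"
    by (rule card_coset_union[OF finite_affine_orb]) (use U_group orb_inf_translate in auto)
  then obtain f where "card (orb None) = 1 + f * card U" using card_orb_inf_affine by (metis dvdE mult.commute)
  moreover have "f \<noteq> 0" using card_orb_inf_ge calculation by auto
  ultimately show ?thesis by (intro exI[of _ f]) simp
qed

text \<open>\<open>D\<close> is the size of the only other singular orbit, and 2k is the order of
  its stabilizers. The weight left over by the orbit of infinity is positive and less than |G|,
  while each further singular orbit uses at least |G|/2; so there is exactly one.\<close>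

lemma second_orbit:
  "\<exists>D k. D * (2 * k) = card G \<and> int D = 2 + int (card (orb None)) * (int (card U) - 2)"
proof -
  define N where "N = int (card (orb None))"
  define Q where "Q = int (card U)"
  define R where "R = sing - orb None"
  have cG: "int (card G) = N * int (card (stab None))"
    unfolding N_def by (rule int_card_orb_stab)
  have inf: "None \<in> sing" using singI[of None] card_U card_U_ge by simp
  have u1: "card (unip x) = 1" if "x \<in> R" for x
    using unip_orb[of x] stab_ge(2)[of x] that by (force simp: R_def)
  have RH: "sum weight R + N * (int (card (stab None)) + 2 * Q - 4) = 2 * int (card G) - 4"
  proof -
    have "sum weight sing = sum weight R + sum weight (orb None)"
      unfolding R_def by (rule sum.subset_diff) (use orb_sing[OF inf] finite_sing in auto)
    then show ?thesis using sum_sing sum_orb[of None] by (simp add: N_def Q_def card_U)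
  qed
  have total: "sum weight R = int (card G) - 4 - 2 * (N * (Q - 2))" using RH cG by (simp add: algebra_simps)
  \<comment> \<open>From |G| = 2NQe with e at least 1, the remaining weight is at least 4N - 4, and
    N is at least 2.\<close>
  have "sum weight R > 0"
  proof -
    obtain e where e: "card (stab None) = 2 * card U * e" "1 \<le> e" using card_stab_inf by blast
    have "N * (2 * Q) * 1 \<le> N * (2 * Q) * int e" using e(2) by (intro mult_left_mono) (auto simp: N_def Q_def)
    then have "int (card G) \<ge> N * (2 * Q)" using cG e(1) by (simp add: Q_def mult.assoc)
    moreover have "N \<ge> 2" using card_orb_inf_ge by (simp add: N_def)
    ultimately show ?thesis using total by (simp add: algebra_simps)
  qed
  then obtain y where y: "y \<in> R" by (metis equals0I less_irrefl sum.empty)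
  have orbR: "orb x \<subseteq> R" if "x \<in> R" for x
    using that orb_sing[of x] orb_disjoint[of x None] by (auto simp: R_def)
  \<comment> \<open>Outside the orbit of infinity the weight is m - 2, where the stabilizer order m
    is even and exceeds 2; hence m is at most 2(m - 2).\<close>
  have half: "2 * sum weight (orb x) \<ge> int (card G)" if x: "x \<in> R" for x
  proof -
    have "card (stab x) \<noteq> 2"
    proof
      assume c: "card (stab x) = 2"
      have "{mone, mneg mone} \<subseteq> stab x" using one_stab by auto
      moreover have "card {mone, mneg mone :: 'a m2} = 2" using minus_one(2) by (simp add: eq_commute)
      ultimately have "stab x = {mone, mneg mone}" using c by (metis card_subset_eq finite_stab)
      then show False using x by (auto simp: R_def sing_def stab_def)
    qed
    then have "card (stab x) \<ge> 4" using even_stab[of x] stab_ge(1)[of x] by presburger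
    then have "int (card (stab x)) \<le> 2 * weight x" using u1[OF x] by simp
    then have "int (card (orb x)) * int (card (stab x)) \<le> int (card (orb x)) * (2 * weight x)"
      by (intro mult_left_mono) auto
    then show ?thesis unfolding sum_orb int_card_orb_stab[of x] by (simp add: algebra_simps)
  qed
  have finR: "finite R" using finite_sing by (simp add: R_def)
  have "R \<subseteq> orb y"
  proof
    fix z assume z: "z \<in> R"
    show "z \<in> orb y"
    proof (rule ccontr)
      assume nz: "z \<notin> orb y"
      have "sum weight (orb y) + sum weight (orb z) = sum weight (orb y \<union> orb z)"
        using orb_disjoint[OF nz] by (simp add: sum.union_disjoint)
      also have "\<dots> \<le> sum weight R"
        using orbR[OF y] orbR[OF z] weight_nonneg by (intro sum_mono2 finR) auto
      also have "\<dots> < int (card G)"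
      proof -
        have "N * (Q - 2) \<ge> 0" using card_U_ge by (simp add: N_def Q_def)
        then show ?thesis using total by linarith
      qed
      finally show False using half[OF y] half[OF z] by simp
    qed
  qed
  then have "R = orb y" using orbR[OF y] by auto
  \<comment> \<open>As orbit size times stabilizer order is |G|, that term cancels and the size of
    \<open>orb y\<close> is determined.\<close>
  then have sw: "int (card (orb y)) * (int (card (stab y)) - 2) = int (card G) - 4 - 2 * (N * (Q - 2))"
    using total sum_orb[of y] u1[OF y] by simp
  then have "int (card (orb y)) = 2 + N * (Q - 2)"
    using int_card_orb_stab[of y] by (simp add: algebra_simps)
  moreover obtain k where "card (stab y) = 2 * k" using even_stab[of y] by blast
  ultimately show ?thesis using card_orb_stab[of y] by (intro exI[of _ "card (orb y)"] exI[of _ k]) (simp add: N_def Q_def)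
qed

lemma card_orb_inf: "card (orb None) = card U + 1 \<or> card U = 3 \<and> card (orb None) = 10"
proof -
  obtain q where q: "card U = q + 2" "q \<ge> 1" using card_U_ge by (intro that[of "card U - 2"]) auto
  obtain f where f: "card (orb None) = 1 + f * (q + 2)" "f \<ge> 1" using card_orb_inf_mod q by auto
  obtain e where e: "card (stab None) = 2 * (q + 2) * e" "1 \<le> e" "e \<le> q + 1" using card_stab_inf q by auto
  obtain D k where D: "D * (2 * k) = card G" "int D = 2 + int (card (orb None)) * (int (card U) - 2)"
    using second_orbit by blast
  have "int D = int (2 + (1 + f * (q + 2)) * q)" using D(2) f q by (simp add: algebra_simps)
  then have "D = 2 + (1 + f * (q + 2)) * q" by (simp only: of_nat_eq_iff)
  \<comment> \<open>This factorisation lets |U| = q + 2 cancel when the two orbits give two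
    expressions for |G|.\<close>
  then have D': "D = (q + 2) * (1 + f * q)" by (simp add: algebra_simps)
  have "2 * (q + 2) * ((1 + f * q) * k) = D * (2 * k)" unfolding D' by (simp add: algebra_simps)
  also have "\<dots> = 2 * (q + 2) * ((1 + f * (q + 2)) * e)"
    unfolding D(1) card_orb_stab[of None] e f by (simp add: algebra_simps)
  finally have "(1 + f * q) * k = (1 + f * (q + 2)) * e" by (simp only: mult_cancel1) simp
  from orbit_size_arith[OF f(2) q(2) e(2,3) this] show ?thesis using f q by auto
qed

end

section \<open>The small orbit: unipotent elements parametrized by a field\<close>

lemma finite_subring_is_subfield:
  fixes S :: "'a::field set"
  assumes fin: "finite S" and "0 \<in> S" "1 \<in> S" and add: "\<And>x y. x \<in> S \<Longrightarrow> y \<in> S \<Longrightarrow> x + y \<in> S"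
    and minus: "\<And>x. x \<in> S \<Longrightarrow> - x \<in> S" and mult: "\<And>x y. x \<in> S \<Longrightarrow> y \<in> S \<Longrightarrow> x * y \<in> S"
  shows "is_subfield S"
proof -
  have "inverse x \<in> S" if x: "x \<in> S" for x
  proof (cases "x = 0")
    case False
    \<comment> \<open>Multiplication by \<open>x\<close> permutes the finite set \<open>S\<close>,
      so it takes the value 1.\<close>
    then have "inj_on ((*) x) S" by (simp add: inj_on_def)
    moreover have "(*) x ` S \<subseteq> S" using mult x by auto
    ultimately have "(*) x ` S = S" using endo_inj_surj[OF fin] by blast
    then obtain y where "y \<in> S" "x * y = 1" using \<open>1 \<in> S\<close> by (metis imageE)
    then show ?thesis by (metis inverse_unique)
  qed (use \<open>0 \<in> S\<close> in simp)
  then show ?thesis using assms by (auto simp: is_subfield_def)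
qed

context finite_sl2_pair
begin

lemma orb_act: "g \<in> G \<Longrightarrow> y \<in> orb x \<Longrightarrow> act g y \<in> orb x"
  using orb_eq[of y x] by (auto simp: orb_def)

lemma double_cancel:
  assumes "y + y = z + (z::'a)" shows "y = z"
proof -
  have "2 * y = 2 * z" using assms by (simp only: mult_2)
  then show ?thesis using two by simp
qed

text \<open>Doubling permutes the finite group \<open>U\<close>, and halves are unique.\<close>

lemma double_mem_U:
  assumes "x + x \<in> U" shows "x \<in> U"
proof -
  have "inj_on (\<lambda>y. y + y) U" using double_cancel by (blast intro: inj_onI)
  moreover have "(\<lambda>y. y + y) ` U \<subseteq> U" using U_group(2) by blast
  ultimately have "(\<lambda>y. y + y) ` U = U" using endo_inj_surj[OF finite_U] by blast
  then have "x + x \<in> (\<lambda>y. y + y) ` U" using assms by simp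
  then obtain y where y: "y \<in> U" "x + x = y + y" by blast
  show ?thesis using double_cancel[OF y(2)] y(1) by simp
qed

lemma U_subset_affine_orb: "U \<subseteq> {a. Some a \<in> orb None}"
  using orb_inf_translate[OF zero_orb] by auto

lemma L_inverse_orb:
  assumes "b \<in> L" "b \<noteq> 0" shows "Some (inverse b) \<in> orb None"
proof -
  have "act (lower b) None = Some (inverse b)" using assms by (simp add: lower_def divide_inverse)
  then show ?thesis using assms by (auto simp: orb_def L_def intro!: image_eqI[of _ _ "lower b"])
qed

text \<open>If the orbit of infinity is as small as it can be, then it is U together with infinity, and
  nonzero elements of L and U are inverse to each other. This gives the monomial elements
  of G, so that U is invariant under multiplication by squares of its elements.\<close>

lemma U_subfield_small_orbit:
  assumes "card (orb None) = card U + 1"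
  shows "is_subfield U \<and> L = U"
proof -
  have "U = {a. Some a \<in> orb None}"
    using card_subset_eq[OF finite_affine_orb U_subset_affine_orb] assms card_orb_inf_affine by simp
  then have invL: "inverse b \<in> U" if "b \<in> L" "b \<noteq> 0" for b using L_inverse_orb[OF that] by auto
  \<comment> \<open>Inversion embeds the nonzero part of \<open>L\<close> in that of
    \<open>U\<close>, and the two have the same size.\<close>
  have "inverse ` (L - {0}) = U - {0}"
  proof (rule card_subset_eq)
    show "inverse ` (L - {0}) \<subseteq> U - {0}" using invL by auto
    have "card (inverse ` (L - {0})) = card (L - {0})" by (intro card_image inj_onI) auto
    then show "card (inverse ` (L - {0})) = card (U - {0})"
      using card_L_eq finite_U finite_L U_group(1) L_group(1) by simp
  qed (use finite_U in simp)
  then have invU: "inverse a \<in> L" if "a \<in> U" "a \<noteq> 0" for a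
    using that by (metis Diff_iff imageE inverse_inverse_eq singletonD)
  \<comment> \<open>A matrix exchanging 0 and infinity; it is a product of three unitriangular
    matrices.\<close>
  define w :: "'a \<Rightarrow> 'a m2" where "w a = Mat2 0 a (- inverse a) 0" for a
  have wG: "w a \<in> G" if a: "a \<in> U" "a \<noteq> 0" for a
  proof -
    have "upper a \<odot> lower (- inverse a) \<odot> upper a = w a" using a by (simp add: upper_def lower_def w_def)
    moreover have "lower (- inverse a) \<in> G" using invU[OF a] L_group(3) by (simp add: L_def)
    ultimately show ?thesis using a mul by (metis U_def mem_Collect_eq)
  qed
  have sqU: "a * a \<in> U" if a: "a \<in> U" for a
  proof (cases "a = 0")
    case False
    \<comment> \<open>Two monomial elements combine to the diagonal matrix with entries a and 1/a,
      which conjugates \<open>upper 1\<close> to \<open>upper (a * a)\<close>.\<close>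
    let ?h = "w a \<odot> minv (w 1)"
    have h: "?h = Mat2 a 0 0 (inverse a)" by (simp add: w_def)
    have hG: "?h \<in> G" using a False wG U_group(4) mul inv by simp
    have "?h \<odot> upper 1 \<odot> minv ?h = upper (a * a)" using False unfolding h by (simp add: upper_def)
    moreover have "?h \<odot> upper 1 \<odot> minv ?h \<in> G" using hG mul inv upper_1 by blast
    ultimately show ?thesis by (simp add: U_def)
  qed (use a in simp)
  \<comment> \<open>Polarization: closure under squares gives 2ab, which is then halved inside
    \<open>U\<close>.\<close>
  have multU: "a * b \<in> U" if "a \<in> U" "b \<in> U" for a b
  proof -
    have "(a + b) * (a + b) + - (a * a) + - (b * b) \<in> U"
      using U_group(2)[OF U_group(2)[OF sqU[OF U_group(2)[OF that]] U_group(3)[OF sqU[OF that(1)]]] U_group(3)[OF sqU[OF that(2)]]] .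
    moreover have "(a + b) * (a + b) + - (a * a) + - (b * b) = a * b + a * b" by (simp add: algebra_simps)
    ultimately show ?thesis using double_mem_U by simp
  qed
  have sub: "is_subfield U"
    using finite_subring_is_subfield[OF finite_U] U_group multU by blast
  have "L = U"
  proof (rule card_subset_eq[OF finite_U])
    show "L \<subseteq> U"
    proof
      fix b assume "b \<in> L"
      then show "b \<in> U" using invL[of b] sub U_group(1) unfolding is_subfield_def by (metis inverse_inverse_eq)
    qed
  qed (rule card_L_eq)
  then show ?thesis using sub by simp
qed

section \<open>The exceptional orbit of ten points\<close>

lemma U_eq_three:
  assumes "card U = 3"
  shows "U = {0, 1, - 1}" "(3::'a) = 0" "L = {0, \<delta>, - \<delta>}"
proof -
  show U: "U = {0, 1, - 1}"
    by (rule card_subset_eq[symmetric, OF finite_U]) (use U_group units_distinct assms in auto)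
  \<comment> \<open>The sum is neither 0 nor 1, so it is -1 and the characteristic is 3.\<close>
  have "1 + 1 \<in> U" using U_group by blast
  then have "(2::'a) \<in> {0, 1, - 1}" using U by simp
  moreover have "(2::'a) \<noteq> 1" by (metis add_cancel_right_right one_add_one zero_neq_one)
  ultimately have "(2::'a) = - 1" using two by blast
  then show "(3::'a) = 0" by (metis add.left_inverse numeral_Bit1 numeral_One one_add_one)
  have "\<delta> \<noteq> - \<delta>"
  proof
    assume "\<delta> = - \<delta>"
    then have "2 * \<delta> = 0" by (metis add.right_inverse mult_2)
    then show False using two delta by simp
  qed
  then show "L = {0, \<delta>, - \<delta>}"
    using L_group delta assms card_L_eq by (intro card_subset_eq[symmetric, OF finite_L]) auto
qed

text \<open>The exceptional case, with group SL(2,5) inside SL(2,9).\<close>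

lemma exceptional_field:
  assumes U3: "card U = 3" and N: "card (orb None) = 10" and nU: "\<delta> \<notin> U"
  defines "S \<equiv> {a + b * \<delta> | a b. a \<in> U \<and> b \<in> U}"
  shows "is_subfield S" "card S = 9"
proof -
  note U = U_eq_three(1)[OF U3] and L = U_eq_three(3)[OF U3]
  have m1: "(2::'a) = - 1" using U_eq_three(2)[OF U3]
    by (metis add.commute eq_neg_iff_add_eq_0 numeral_Bit1 numeral_One one_add_one)
  have multU: "x * y \<in> U" if "x \<in> U" "y \<in> U" for x y using that U by auto
  \<comment> \<open>The elements 1 and \<open>x\<close> are linearly independent over the
    three-element field \<open>U\<close>.\<close>
  have card9: "card {a + b * x | a b. a \<in> U \<and> b \<in> U} = 9" if x: "x \<notin> U" for x
  proof -
    have "{a + b * x | a b. a \<in> U \<and> b \<in> U} = (\<lambda>(a, b). a + b * x) ` (U \<times> U)" by auto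
    moreover have "inj_on (\<lambda>(a, b). a + b * x) (U \<times> U)"
    proof (rule inj_onI, clarify)
      fix a b a' b' assume in_U: "a \<in> U" "b \<in> U" "a' \<in> U" "b' \<in> U" and e: "a + b * x = a' + b' * x"
      have d: "b + - b' \<in> U" "a' + - a \<in> U" using in_U U_group by blast+
      have e': "(b + - b') * x = a' + - a" using e by (simp add: algebra_simps)
      have "b + - b' = 0"
      proof (rule ccontr)
        assume "b + - b' \<noteq> 0"
        \<comment> \<open>Nonzero elements of \<open>U\<close> are 1 or -1, hence their own
          inverses; this solves the relation for \<open>x\<close>.\<close>
        then have "(b + - b') * (b + - b') = 1" using d(1) U by auto
        then have "x = (b + - b') * ((b + - b') * x)" by (metis mult.assoc mult_1)
        then have "x \<in> U" using e' d multU by metis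
        then show False using x by simp
      qed
      then have "b = b'" by simp
      then show "a = a' \<and> b = b'" using e by (metis add_right_cancel)
    qed
    ultimately show ?thesis using U3 by (simp add: card_image card_cartesian_product)
  qed
  show S9: "card S = 9" unfolding S_def using card9[OF nU] .
  let ?\<theta> = "inverse \<delta>"
  have th: "?\<theta> \<notin> U"
  proof
    assume "?\<theta> \<in> U"
    then have "?\<theta> = 0 \<or> ?\<theta> = 1 \<or> ?\<theta> = - 1" unfolding U by blast
    then have "\<delta> = 0 \<or> \<delta> = 1 \<or> \<delta> = - 1"
      by (metis inverse_1 inverse_inverse_eq inverse_minus_eq inverse_zero)
    then show False using nU U by blast
  qed
  \<comment> \<open>The elements of \<open>L\<close> move infinity to 1/\<delta> and -1/\<delta>;
    translations by \<open>U\<close> give the other points.\<close>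
  have "{a + b * ?\<theta> | a b. a \<in> U \<and> b \<in> U} \<subseteq> {a. Some a \<in> orb None}"
  proof clarify
    fix a b assume a: "a \<in> U" and b: "b \<in> U"
    have "Some (b * ?\<theta>) \<in> orb None"
      using b L_inverse_orb[of \<delta>] L_inverse_orb[of "- \<delta>"] zero_orb delta L U by auto
    from orb_inf_translate[OF this a] show "Some (a + b * ?\<theta>) \<in> orb None" by (simp add: add.commute)
  qed
  then have th1: "Some (1 + 1 * ?\<theta>) \<in> orb None" using U_group(4) by blast
  \<comment> \<open>The chart around infinity, in which \<open>lower l\<close> acts as translation
    by \<open>l\<close>.\<close>
  define \<iota> :: "'a \<Rightarrow> 'a option" where "\<iota> y = (if y = 0 then None else Some (inverse y))" for y
  define B where "B = {y. \<iota> y \<in> orb None}"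
  have \<iota>_inj: "inj \<iota>" by (auto simp: \<iota>_def inj_def)
  have fB: "finite B" unfolding B_def using finite_vimageI[OF finite_orb \<iota>_inj] by (simp add: vimage_def)
  \<comment> \<open>The chart misses the point 0, which lies in the orbit, so at most nine points
    are left for \<open>B\<close>.\<close>
  have "\<iota> ` B \<subseteq> orb None - {Some 0}" by (auto simp: B_def \<iota>_def)
  then have "card (\<iota> ` B) \<le> card (orb None - {Some 0})" by (intro card_mono) auto
  then have "card B \<le> 9" using N zero_orb \<iota>_inj by (simp add: card_image inj_on_subset)
  have \<iota>_lower: "\<iota> (y + l) = act (lower l) (\<iota> y)" for y l
  proof (cases "y = 0")
    case False
    have "inverse y / (l * inverse y + 1) = inverse (y + l)" if "y + l \<noteq> 0"
      using False that by (simp add: field_simps)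
    moreover have "l * inverse y + 1 = 0 \<longleftrightarrow> y + l = 0"
      using False by (simp add: field_simps add.commute)
    ultimately show ?thesis using False by (auto simp: \<iota>_def lower_def)
  qed (auto simp: \<iota>_def lower_def divide_inverse)
  have B_trans: "y + l \<in> B" if "y \<in> B" "l \<in> L" for y l
    using that orb_act[of "lower l" "\<iota> y" None] by (simp add: B_def L_def \<iota>_lower)
  \<comment> \<open>Inversion preserves the nonzero part of \<open>U\<close>, so \<open>U\<close>
    lies in \<open>B\<close>; translating by multiples of \<delta> from \<open>L\<close> gives all
    of \<open>S\<close>.\<close>
  have "S \<subseteq> B"
  proof
    fix y assume "y \<in> S"
    then obtain a b where ab: "a \<in> U" "b \<in> U" "y = a + b * \<delta>" by (auto simp: S_def)
    have "inverse a \<in> U" using ab(1) U by auto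
    then have "a \<in> B" using U_subset_affine_orb orb_self by (auto simp: B_def \<iota>_def)
    moreover have "b * \<delta> \<in> L" using ab(2) U L by auto
    ultimately show "y \<in> B" using B_trans ab(3) by simp
  qed
  then have "S = B" using card_seteq[OF fB] \<open>card B \<le> 9\<close> S9 by simp
  have nz: "1 + ?\<theta> \<noteq> 0" using th U by (metis eq_neg_iff_add_eq_0 add.commute insertCI)
  \<comment> \<open>The point 1 + 1/\<delta> of the orbit, read in the other chart, must lie in
    \<open>S\<close>. This is the source of the quadratic equation for \<delta> over
    \<open>U\<close>.\<close>
  then have "inverse (1 + ?\<theta>) \<in> B" using th1 by (simp add: B_def \<iota>_def)
  then obtain a b where ab: "a \<in> U" "b \<in> U" "inverse (1 + ?\<theta>) = a + b * \<delta>"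
    using \<open>S = B\<close> by (auto simp: S_def)
  have "(1 + ?\<theta>) * (a + b * \<delta>) = 1" using ab(3) nz by (metis right_inverse)
  then have "\<delta> * ((1 + ?\<theta>) * (a + b * \<delta>)) = \<delta>" by simp
  moreover have "\<delta> * ((1 + ?\<theta>) * (a + b * \<delta>)) = (\<delta> + \<delta> * ?\<theta>) * (a + b * \<delta>)" by (simp add: algebra_simps)
  ultimately have rel: "(\<delta> + 1) * (a + b * \<delta>) = \<delta>" using delta by simp
  \<comment> \<open>Otherwise the relation would be linear and either be contradictory or put
    \<delta> in \<open>U\<close>.\<close>
  have "b \<noteq> 0"
  proof
    assume b0: "b = 0"
    then have r: "(\<delta> + 1) * a = \<delta>" using rel by simp
    consider "a = 0" | "a = 1" | "a = - 1" using ab U by auto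
    then show False
    proof cases
      case 3
      then have "- \<delta> = \<delta> + 1" using r by (metis minus_minus mult_minus1_right)
      moreover have "- \<delta> = \<delta> + \<delta>" using m1 by (metis mult_2 mult_minus1)
      ultimately have "\<delta> = 1" by simp
      then show ?thesis using nU U by simp
    qed (use r delta in auto)
  qed
  then have bb: "b * b = 1" using ab U by auto
  \<comment> \<open>The relation is solved for the square of \<delta> by multiplying with
    \<open>b\<close>, its own inverse; this closes \<open>S\<close> under products.\<close>
  have dd: "\<delta> * \<delta> = b * (- a) + b * (1 + - a + - b) * \<delta>"
  proof -
    have "b * (\<delta> * \<delta>) = - a + (1 + - a + - b) * \<delta>" using rel by (simp add: algebra_simps)
    then have "b * (b * (\<delta> * \<delta>)) = b * (- a + (1 + - a + - b) * \<delta>)" by simp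
    moreover have "b * (b * (\<delta> * \<delta>)) = \<delta> * \<delta>" using bb by (metis mult.assoc mult_1)
    ultimately have "\<delta> * \<delta> = b * (- a + (1 + - a + - b) * \<delta>)" by metis
    also have "\<dots> = b * (- a) + b * (1 + - a + - b) * \<delta>" by (simp add: algebra_simps)
    finally show ?thesis .
  qed
  define e f where "e = b * (- a)" and "f = b * (1 + - a + - b)"
  have ef: "e \<in> U" "f \<in> U" unfolding e_def f_def
    using multU[OF ab(2) U_group(3)[OF ab(1)]]
      multU[OF ab(2) U_group(2)[OF U_group(2)[OF U_group(4) U_group(3)[OF ab(1)]] U_group(3)[OF ab(2)]]] .
  show "is_subfield S"
  proof (rule finite_subring_is_subfield)
    show "finite S" using fB \<open>S = B\<close> by simp
    have SI: "x + y * \<delta> \<in> S" if "x \<in> U" "y \<in> U" for x y using that by (auto simp: S_def)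
    show "0 \<in> S" "1 \<in> S" using SI[of 0 0] SI[of 1 0] U_group by auto
    fix x assume "x \<in> S"
    then obtain c d where cd: "c \<in> U" "d \<in> U" "x = c + d * \<delta>" by (auto simp: S_def)
    have "- x = (- c) + (- d) * \<delta>" using cd by simp
    then show "- x \<in> S" using SI[of "- c" "- d"] cd U_group by simp
    fix y assume "y \<in> S"
    then obtain c' d' where cd': "c' \<in> U" "d' \<in> U" "y = c' + d' * \<delta>" by (auto simp: S_def)
    have "x + y = (c + c') + (d + d') * \<delta>" using cd cd' by (simp add: algebra_simps)
    then show "x + y \<in> S" using SI[OF U_group(2)[OF cd(1) cd'(1)] U_group(2)[OF cd(2) cd'(2)]] by metis
    have "x * y = c * c' + (c * d' + d * c') * \<delta> + d * d' * (\<delta> * \<delta>)"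
      unfolding cd(3) cd'(3) by (simp add: algebra_simps)
    also have "\<dots> = (c * c' + d * d' * e) + (c * d' + d * c' + d * d' * f) * \<delta>"
      unfolding dd e_def[symmetric] f_def[symmetric] by (simp add: algebra_simps)
    finally show "x * y \<in> S"
      using SI[OF U_group(2)[OF multU[OF cd(1) cd'(1)] multU[OF multU[OF cd(2) cd'(2)] ef(1)]]
        U_group(2)[OF U_group(2)[OF multU[OF cd(1) cd'(2)] multU[OF cd(2) cd'(1)]]
          multU[OF multU[OF cd(2) cd'(2)] ef(2)]]] by metis
  qed
qed

text \<open>If the orbit is small, \<open>U\<close> = \<open>L\<close> is a field containing all
  generators: \<open>l\<close> is recovered from l\<delta> by dividing by \<delta>. If |U| = 3 and
  the orbit has ten points, the same works when \<delta> lies in \<open>U\<close>; otherwise the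
  generated field is \<open>S\<close>, of order 9, which is excluded.\<close>

lemma subfield_gen_subset:
  assumes K: "\<And>k. k \<in> K \<Longrightarrow> upper k \<in> G" and \<Lambda>: "\<And>l. l \<in> \<Lambda> \<Longrightarrow> lower (l * \<delta>) \<in> G"
    and "1 \<in> \<Lambda>" and not9: "card (subfield_gen (K \<union> \<Lambda> \<union> {\<delta>})) \<noteq> 9"
  shows "subfield_gen (K \<union> \<Lambda> \<union> {\<delta>}) \<subseteq> U \<inter> L"
proof -
  have KU: "K \<subseteq> U" and \<Lambda>L: "l * \<delta> \<in> L" if "l \<in> \<Lambda>" for l using K \<Lambda> that by (auto simp: U_def L_def)
  have *: "subfield_gen (K \<union> \<Lambda> \<union> {\<delta>}) \<subseteq> U \<inter> L" if sub: "is_subfield U" and LU: "L = U"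
  proof -
    have "\<Lambda> \<subseteq> U"
    proof
      fix l assume "l \<in> \<Lambda>"
      then have "(l * \<delta>) * inverse \<delta> \<in> U" using sub LU \<Lambda>L L_group(4) unfolding is_subfield_def by blast
      then show "l \<in> U" using delta by (simp add: mult.assoc)
    qed
    then have "subfield_gen (K \<union> \<Lambda> \<union> {\<delta>}) \<subseteq> U"
      unfolding subfield_gen_def using sub KU[OF \<open>1 \<in> \<Lambda>\<close>] LU L_group(4) by (intro Inter_lower) auto
    then show ?thesis using LU by simp
  qed
  show ?thesis
  proof (cases "card (orb None) = card U + 1")
    case True
    then show ?thesis using * U_subfield_small_orbit by blast
  next
    case False
    then have U3: "card U = 3" and N: "card (orb None) = 10" using card_orb_inf by auto
    note U = U_eq_three(1)[OF U3] and L = U_eq_three(3)[OF U3]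
    show ?thesis
    proof (cases "\<delta> \<in> U")
      case True
      then have "L = U" using U L delta by auto
      moreover have "is_subfield U"
      proof (rule finite_subring_is_subfield)
        show "x * y \<in> U" if "x \<in> U" "y \<in> U" for x y using that U by auto
      qed (use finite_U U_group in auto)
      ultimately show ?thesis using * by blast
    next
      case False
      define S where "S = {a + b * \<delta> | a b. a \<in> U \<and> b \<in> U}"
      have S: "is_subfield S" "card S = 9" using exceptional_field[OF U3 N False] by (simp_all add: S_def)
      have SI: "x + y * \<delta> \<in> S" if "x \<in> U" "y \<in> U" for x y using that by (auto simp: S_def)
      have US: "U \<subseteq> S" using SI[of _ 0] U_group(1) by auto
      moreover have "\<delta> \<in> S" using SI[of 0 1] U_group by simp
      moreover have "\<Lambda> \<subseteq> U"
      proof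
        fix l assume "l \<in> \<Lambda>"
        then have "l * \<delta> = 0 \<or> l * \<delta> = 1 * \<delta> \<or> l * \<delta> = (- 1) * \<delta>" using \<Lambda>L L by auto
        then show "l \<in> U" using delta U by (metis insertCI mult_cancel_right mult_zero_left)
      qed
      ultimately have "subfield_gen (K \<union> \<Lambda> \<union> {\<delta>}) \<subseteq> S"
        unfolding subfield_gen_def using S(1) KU[OF \<open>1 \<in> \<Lambda>\<close>] by (intro Inter_lower) auto
      moreover have "S \<subseteq> subfield_gen (K \<union> \<Lambda> \<union> {\<delta>})"
        unfolding subfield_gen_def
      proof (intro Inter_greatest, clarify)
        fix x F assume F: "is_subfield F" "K \<union> \<Lambda> \<union> {\<delta>} \<subseteq> F" and "x \<in> S"
        then obtain a b where "a \<in> U" "b \<in> U" "x = a + b * \<delta>" by (auto simp: S_def)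
        moreover have "U \<subseteq> F" using F(1) unfolding U is_subfield_def by auto
        ultimately show "x \<in> F" using F unfolding is_subfield_def by blast
      qed
      ultimately have "subfield_gen (K \<union> \<Lambda> \<union> {\<delta>}) = S" by blast
      then show ?thesis using not9 S(2) by simp
    qed
  qed
qed

end

section \<open>Passage to the algebraic closure\<close>

lemma alg_closed_sqrt: "\<exists>r. r * r = (x::'a::alg_closed_field)"
proof -
  have "\<exists>r. poly [:- x, 0, 1:] r = 0" by (rule alg_closed_imp_poly_has_root) simp
  then show ?thesis by auto
qed

instance m2 :: (finite) finite
proof
  have "UNIV = (\<lambda>(a, b, c, d). Mat2 a b c d) ` (UNIV :: ('a \<times> 'a \<times> 'a \<times> 'a) set)"
    by (auto simp: image_iff) (metis m2.exhaust)
  then show "finite (UNIV :: 'a m2 set)" by (metis finite finite_imageI)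
qed

lemma is_subfield_subfield_gen: "is_subfield (subfield_gen S)"
  unfolding is_subfield_def subfield_gen_def by auto

lemma subset_subfield_gen: "S \<subseteq> subfield_gen S"
  unfolding subfield_gen_def by auto

lemma subfield_gen_least: "is_subfield F \<Longrightarrow> S \<subseteq> F \<Longrightarrow> subfield_gen S \<subseteq> F"
  unfolding subfield_gen_def by auto

text \<open>Preimages and images of subfields under the embedding are subfields, so each inclusion
  follows from minimality.\<close>

lemma to_ac_subfield_gen: "to_ac ` subfield_gen S = subfield_gen (to_ac ` S)"
proof
  have "is_subfield {x. to_ac x \<in> subfield_gen (to_ac ` S)}"
    using is_subfield_subfield_gen[of "to_ac ` S"] by (simp add: is_subfield_def)
  moreover have "S \<subseteq> {x. to_ac x \<in> subfield_gen (to_ac ` S)}"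
    using subset_subfield_gen[of "to_ac ` S"] by auto
  ultimately show "to_ac ` subfield_gen S \<subseteq> subfield_gen (to_ac ` S)"
    using subfield_gen_least by blast
next
  have "is_subfield (to_ac ` subfield_gen S)"
    using is_subfield_subfield_gen[of S] unfolding is_subfield_def
    by (auto simp flip: to_ac_add to_ac_mult to_ac_minus to_ac_inverse to_ac_0 to_ac_1 simp del: to_ac_eq_0_iff)
  then show "subfield_gen (to_ac ` S) \<subseteq> to_ac ` subfield_gen S"
    using subset_subfield_gen by (intro subfield_gen_least) auto
qed

abbreviation lift_ac :: "'a::field m2 \<Rightarrow> 'a alg_closure m2" where
  "lift_ac \<equiv> map_m2 to_ac"

lemma lift_ac_simps:
  "lift_ac (g \<odot> h) = lift_ac g \<odot> lift_ac h" "lift_ac (minv g) = minv (lift_ac g)"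
  "lift_ac (mneg g) = mneg (lift_ac g)" "mdet (lift_ac g) = to_ac (mdet g)"
  "lift_ac mone = mone" "lift_ac (upper x) = upper (to_ac x)" "lift_ac (lower x) = lower (to_ac x)"
  by (cases g; cases h; simp add: mone_def upper_def lower_def)+

lemma inj_lift_ac: "inj lift_ac"
  by (rule m2.inj_map[OF inj_to_ac])

text \<open>The orbit count applies to the image of \<open>G\<close>, enlarged by -1, over the
  algebraic closure. The sign is removed at the end: \<open>upper x\<close> is the square of
  \<open>upper (x / 2)\<close>, and the square of g or -g lies in \<open>G\<close>.\<close>

lemma root_subgroups_mem:
  fixes G :: "'a::{field,finite} m2 set"
  assumes two: "(2::'a) \<noteq> 0"
    and one: "mone \<in> G" and mul: "\<And>g h. g \<in> G \<Longrightarrow> h \<in> G \<Longrightarrow> g \<odot> h \<in> G"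
    and inv: "\<And>g. g \<in> G \<Longrightarrow> minv g \<in> G" and det: "\<And>g. g \<in> G \<Longrightarrow> mdet g = 1"
    and K: "\<And>k. k \<in> K \<Longrightarrow> upper k \<in> G" "1 \<in> K"
    and \<Lambda>: "\<And>l. l \<in> \<Lambda> \<Longrightarrow> lower (l * \<delta>) \<in> G" "1 \<in> \<Lambda>"
    and delta: "\<delta> \<noteq> 0" and not9: "card (subfield_gen (K \<union> \<Lambda> \<union> {\<delta>})) \<noteq> 9"
    and x: "x \<in> subfield_gen (K \<union> \<Lambda> \<union> {\<delta>})"
  shows "upper x \<in> G" "lower x \<in> G"
proof -
  let ?M = "subfield_gen (K \<union> \<Lambda> \<union> {\<delta>})"
  define G' where "G' = G \<union> mneg ` G"
  have mneg_inv: "minv (mneg g) = mneg (minv g)" and mneg_det: "mdet (mneg g) = mdet g" for g :: "'a m2"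
    by (cases g; simp)+
  have G': "mone \<in> G'" "g \<in> G' \<Longrightarrow> h \<in> G' \<Longrightarrow> g \<odot> h \<in> G'" "g \<in> G' \<Longrightarrow> minv g \<in> G'"
    "g \<in> G' \<Longrightarrow> mdet g = 1" "g \<in> G' \<Longrightarrow> mneg g \<in> G'" for g h
    unfolding G'_def using one mul inv det by (auto simp: mneg_mmul mneg_inv mneg_det)
  interpret ac: finite_sl2_pair "lift_ac ` G'" "to_ac \<delta>"
  proof
    show "mone \<in> lift_ac ` G'" using G'(1) by (metis image_eqI lift_ac_simps(5))
    show "(2::'a alg_closure) \<noteq> 0" using two by (metis to_ac_eq_0_iff to_ac_numeral)
    show "\<exists>r. r * r = y" for y :: "'a alg_closure" by (rule alg_closed_sqrt)
    show "upper 1 \<in> lift_ac ` G'" using K by (auto simp: G'_def lift_ac_simps intro!: image_eqI[of _ _ "upper 1"])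
    show "lower (to_ac \<delta>) \<in> lift_ac ` G'" using \<Lambda>(1)[OF \<Lambda>(2)]
      by (auto simp: G'_def lift_ac_simps intro!: image_eqI[of _ _ "lower \<delta>"])
  qed (use G' delta in \<open>auto simp flip: lift_ac_simps simp: lift_ac_simps(4)\<close>)
  have ac: "to_ac ` ?M = subfield_gen (to_ac ` K \<union> to_ac ` \<Lambda> \<union> {to_ac \<delta>})"
    by (simp add: to_ac_subfield_gen image_Un)
  then have "card (subfield_gen (to_ac ` K \<union> to_ac ` \<Lambda> \<union> {to_ac \<delta>})) = card ?M"
    by (metis card_image inj_on_subset inj_to_ac top_greatest)
  then have sub: "to_ac ` ?M \<subseteq> ac.U \<inter> ac.L" unfolding ac
  proof (intro ac.subfield_gen_subset)
    show "upper k \<in> lift_ac ` G'" if "k \<in> to_ac ` K" for k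
      using that K by (auto simp: G'_def simp flip: lift_ac_simps)
    show "lower (l * to_ac \<delta>) \<in> lift_ac ` G'" if "l \<in> to_ac ` \<Lambda>" for l
      using that \<Lambda> by (auto simp: G'_def simp flip: lift_ac_simps to_ac_mult)
    show "1 \<in> to_ac ` \<Lambda>" using \<Lambda>(2) by (metis image_eqI to_ac_1)
  qed (use not9 in simp)
  have double: "g \<odot> g \<in> G" if "g \<in> G'" for g
    using that mul by (auto simp: G'_def mneg_mmul)
  \<comment> \<open>Half of \<open>x\<close>, with 2 written as 1 + 1 so that the closure rules of a
    subfield apply.\<close>
  define y where "y = x * inverse (1 + 1)"
  have y: "y \<in> ?M" "x = y + y"
  proof -
    show "y \<in> ?M" unfolding y_def
      using is_subfield_subfield_gen[of "K \<union> \<Lambda> \<union> {\<delta>}"] x unfolding is_subfield_def by blast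
    show "x = y + y" using two unfolding y_def by (simp add: field_simps)
  qed
  have "upper (to_ac y) \<in> lift_ac ` G'" "lower (to_ac y) \<in> lift_ac ` G'"
    using sub y(1) by (auto simp: ac.U_def ac.L_def)
  then have "upper y \<in> G'" "lower y \<in> G'"
    unfolding lift_ac_simps(6,7)[symmetric] inj_image_mem_iff[OF inj_lift_ac] .
  from double[OF this(1)] double[OF this(2)] show "upper x \<in> G" "lower x \<in> G"
    by (simp_all add: y(2) upper_def lower_def)
qed

section \<open>Generation of SL(2,M) by unitriangular matrices\<close>

lemma SL2_generated:
  fixes G :: "'a::field m2 set"
  assumes mul: "\<And>g h. g \<in> G \<Longrightarrow> h \<in> G \<Longrightarrow> g \<odot> h \<in> G" and M: "is_subfield M"
    and up: "\<And>x. x \<in> M \<Longrightarrow> upper x \<in> G" and low: "\<And>x. x \<in> M \<Longrightarrow> lower x \<in> G"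
    and in_M: "a \<in> M" "b \<in> M" "c \<in> M" "d \<in> M" and det: "a * d - b * c = 1"
  shows "Mat2 a b c d \<in> G"
proof -
  have M': "0 \<in> M" "1 \<in> M" "\<And>x y. x \<in> M \<Longrightarrow> y \<in> M \<Longrightarrow> x + y \<in> M" "\<And>x. x \<in> M \<Longrightarrow> - x \<in> M"
    "\<And>x y. x \<in> M \<Longrightarrow> y \<in> M \<Longrightarrow> x * inverse y \<in> M"
    using M unfolding is_subfield_def by blast+
  have *: "Mat2 a b c d \<in> G" if c: "c \<noteq> 0" and in_M: "a \<in> M" "c \<in> M" "d \<in> M" and det: "a * d - b * c = 1"
    for a b c d
  proof -
    \<comment> \<open>These values match the diagonal of
      \<open>upper s \<odot> lower c \<odot> upper t\<close>; the determinant then fixes the upper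
      right entry.\<close>
    define s t where "s = (a + - 1) * inverse c" and "t = (d + - 1) * inverse c"
    have "s * c = a - 1" "c * t = d - 1" "b = a * t + s"
      using c det by (simp_all add: s_def t_def field_simps)
    then have "upper s \<odot> lower c \<odot> upper t = Mat2 a b c d"
      by (simp add: upper_def lower_def)
    moreover have "s \<in> M" "t \<in> M"
      unfolding s_def t_def using in_M M'(5)[OF M'(3)[OF _ M'(4)[OF M'(2)]]] by blast+
    ultimately show ?thesis using mul up low in_M(2) by metis
  qed
  show ?thesis
  proof (cases "c = 0")
    case True
    have "a \<noteq> 0" using det True by auto
    \<comment> \<open>Adding the first row to the second makes the lower left entry nonzero.\<close>
    then have "Mat2 a b a (b + d) \<in> G" using * in_M M'(3) det True by (simp add: algebra_simps)
    moreover have "lower (- 1) \<odot> Mat2 a b a (b + d) = Mat2 a b c d" using True by (simp add: lower_def)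
    ultimately show ?thesis using mul low M'(2,4) by metis
  qed (use * in_M det in blast)
qed

section \<open>Embedding two-by-two matrices in dimension n\<close>

lemma appf_add: "appf f (x + y) = appf f x + appf f y"
  by (simp add: appf_def distrib_left sum.distrib)

lemma appf_scale: "appf f (c *s x) = c * appf f x" "appf (c *s f) x = c * appf f x"
  by (simp_all add: appf_def sum_distrib_left mult_ac)

text \<open>\<open>matrix_inv\<close> is given by choice, and two-sided inverses are unique.\<close>

lemma matrix_inv_eq:
  fixes A B :: "'a::field ^ 'n ^ 'n"
  assumes "A ** B = mat 1" "B ** A = mat 1"
  shows "matrix_inv A = B"
proof -
  have "A ** matrix_inv A = mat 1 \<and> matrix_inv A ** A = mat 1"
    unfolding matrix_inv_def by (rule someI[of _ B]) (use assms in simp)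
  then show ?thesis using assms by (metis matrix_mul_assoc matrix_mul_lid matrix_mul_rid)
qed

text \<open>The functionals split the space as the span of \<open>b1\<close>, \<open>b2\<close> plus
  the common kernel of \<open>f1\<close>, \<open>f2\<close>, without choosing a basis of that
  kernel.\<close>

locale dual_pair =
  fixes b1 b2 f1 f2 :: "'a::field ^ 'n"
  assumes dual: "appf f1 b1 = 1" "appf f1 b2 = 0" "appf f2 b1 = 0" "appf f2 b2 = 1"
begin

text \<open>The block sum of g and the identity on the common kernel: the identity plus the entries
  of g - 1 times rank-one maps.\<close>

fun emb :: "'a m2 \<Rightarrow> 'a ^ 'n ^ 'n" where
  "emb (Mat2 a b c d) = (\<chi> i j. (if i = j then 1 else 0)
     + ((a - 1) * f1 $ j + b * f2 $ j) * b1 $ i + (c * f1 $ j + (d - 1) * f2 $ j) * b2 $ i)"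

declare emb.simps [simp del]

lemma emb_apply: "emb (Mat2 a b c d) *v x =
    x + ((a - 1) * appf f1 x + b * appf f2 x) *s b1 + (c * appf f1 x + (d - 1) * appf f2 x) *s b2"
proof (rule vec_eq_iff[THEN iffD2], rule allI)
  fix i
  have "(emb (Mat2 a b c d) *v x) $ i = (\<Sum>j\<in>UNIV. (if i = j then x $ j else 0)
      + ((a - 1) * b1 $ i * (f1 $ j * x $ j) + b * b1 $ i * (f2 $ j * x $ j))
      + (c * b2 $ i * (f1 $ j * x $ j) + (d - 1) * b2 $ i * (f2 $ j * x $ j)))"
    unfolding matrix_vector_mult_def emb.simps
    by simp (rule sum.cong; simp add: algebra_simps)
  also have "\<dots> = x $ i + ((a - 1) * b1 $ i * appf f1 x + b * b1 $ i * appf f2 x)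
      + (c * b2 $ i * appf f1 x + (d - 1) * b2 $ i * appf f2 x)"
    by (simp add: sum.distrib appf_def flip: sum_distrib_left)
  finally show "(emb (Mat2 a b c d) *v x) $ i =
      (x + ((a - 1) * appf f1 x + b * appf f2 x) *s b1 + (c * appf f1 x + (d - 1) * appf f2 x) *s b2) $ i"
    by (simp add: algebra_simps)
qed

lemma emb_basis:
  "emb (Mat2 a b c d) *v b1 = a *s b1 + c *s b2"
  "emb (Mat2 a b c d) *v b2 = b *s b1 + d *s b2"
  "appf f1 w = 0 \<Longrightarrow> appf f2 w = 0 \<Longrightarrow> emb (Mat2 a b c d) *v w = w"
  unfolding emb_apply by (simp_all add: dual vec_eq_iff algebra_simps)

lemma decomp: "x = appf f1 x *s b1 + appf f2 x *s b2 + (x - appf f1 x *s b1 - appf f2 x *s b2)"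
  by simp

lemma complement:
  "appf f1 (x - appf f1 x *s b1 - appf f2 x *s b2) = 0"
  "appf f2 (x - appf f1 x *s b1 - appf f2 x *s b2) = 0"
proof -
  have "appf f (y - z) = appf f y - appf f z" for f y z :: "'a ^ 'n"
    by (simp add: appf_def right_diff_distrib sum_subtractf)
  then show "appf f1 (x - appf f1 x *s b1 - appf f2 x *s b2) = 0"
    "appf f2 (x - appf f1 x *s b1 - appf f2 x *s b2) = 0"
    by (simp_all add: appf_scale dual)
qed

lemma emb_unique:
  assumes "g *v b1 = a *s b1 + c *s b2" "g *v b2 = b *s b1 + d *s b2"
    and "\<And>w. appf f1 w = 0 \<Longrightarrow> appf f2 w = 0 \<Longrightarrow> g *v w = w"
  shows "g = emb (Mat2 a b c d)"
proof -
  have "g *v x = emb (Mat2 a b c d) *v x" for x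
  proof -
    define w where "w = x - appf f1 x *s b1 - appf f2 x *s b2"
    have w: "appf f1 w = 0" "appf f2 w = 0" unfolding w_def by (rule complement)+
    have x: "x = appf f1 x *s b1 + appf f2 x *s b2 + w" unfolding w_def by (rule decomp)
    have "h *v x = appf f1 x *s (h *v b1) + appf f2 x *s (h *v b2) + h *v w" for h :: "'a ^ 'n ^ 'n"
      by (subst x) (simp add: matrix_vector_right_distrib vector_scalar_commute)
    then show ?thesis using assms w by (simp add: emb_basis)
  qed
  then show ?thesis by (simp add: matrix_eq)
qed

lemma emb_mmul: "emb (g \<odot> h) = emb g ** emb h"
proof -
  obtain a b c d where g: "g = Mat2 a b c d" by (cases g)
  obtain a' b' c' d' where h: "h = Mat2 a' b' c' d'" by (cases h)
  have "emb g ** emb h = emb (Mat2 (a * a' + b * c') (a * b' + b * d') (c * a' + d * c') (c * b' + d * d'))"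
    unfolding g h
    by (rule emb_unique; simp add: emb_basis matrix_vector_right_distrib vector_scalar_commute flip: matrix_vector_mul_assoc)
       (simp_all add: vec_eq_iff algebra_simps)
  then show ?thesis by (simp add: g h)
qed

lemma emb_mone: "emb mone = mat 1"
  by (simp add: mone_def mat_def emb.simps)

lemma emb_minv: "mdet g = 1 \<Longrightarrow> matrix_inv (emb g) = emb (minv g)"
  by (intro matrix_inv_eq) (simp_all add: emb_mone flip: emb_mmul)

text \<open>The complement is the common kernel of \<open>f1\<close> and \<open>f2\<close>, and
  duality makes \<open>appf f1 x\<close> and \<open>appf f2 x\<close> the unique coordinates of
  \<open>x\<close>.\<close>

lemma SL2_plus_id_emb:
  "SL2_plus_id (emb ` {Mat2 a b c d | a b c d. a \<in> M \<and> b \<in> M \<and> c \<in> M \<and> d \<in> M \<and> a * d - b * c = 1}) M"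
  unfolding SL2_plus_id_def
proof (intro exI conjI)
  let ?W = "{w. appf f1 w = 0 \<and> appf f2 w = 0}"
  show "is_subspace ?W"
    by (auto simp: is_subspace_def appf_add appf_scale) (simp_all add: appf_def)
  show "\<forall>x. \<exists>!(\<alpha>, \<beta>, w). w \<in> ?W \<and> x = \<alpha> *s b1 + \<beta> *s b2 + w"
  proof
    fix x
    show "\<exists>!(\<alpha>, \<beta>, w). w \<in> ?W \<and> x = \<alpha> *s b1 + \<beta> *s b2 + w"
    proof (rule ex1I[of _ "(appf f1 x, appf f2 x, x - appf f1 x *s b1 - appf f2 x *s b2)"])
      show "case (appf f1 x, appf f2 x, x - appf f1 x *s b1 - appf f2 x *s b2) of (\<alpha>, \<beta>, w) \<Rightarrow> w \<in> ?W \<and> x = \<alpha> *s b1 + \<beta> *s b2 + w"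
        using complement by simp
    next
      fix y assume "case y of (\<alpha>, \<beta>, w) \<Rightarrow> w \<in> ?W \<and> x = \<alpha> *s b1 + \<beta> *s b2 + w"
      then obtain \<alpha> \<beta> w where y: "y = (\<alpha>, \<beta>, w)" "appf f1 w = 0" "appf f2 w = 0" and x: "x = \<alpha> *s b1 + \<beta> *s b2 + w"
        by (cases y) auto
      have "appf f1 x = \<alpha>" "appf f2 x = \<beta>" unfolding x by (simp_all add: appf_add appf_scale dual y)
      then show "y = (appf f1 x, appf f2 x, x - appf f1 x *s b1 - appf f2 x *s b2)"
        using y(1) x by simp
    qed
  qed
  show "emb ` {Mat2 a b c d | a b c d. a \<in> M \<and> b \<in> M \<and> c \<in> M \<and> d \<in> M \<and> a * d - b * c = 1} =
    {g. \<exists>a b c d. a \<in> M \<and> b \<in> M \<and> c \<in> M \<and> d \<in> M \<and> a * d - b * c = 1 \<and>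
        g *v b1 = a *s b1 + c *s b2 \<and> g *v b2 = b *s b1 + d *s b2 \<and> (\<forall>w\<in>?W. g *v w = w)}" (is "?L = ?R")
  proof
    show "?L \<subseteq> ?R"
    proof
      fix g assume "g \<in> ?L"
      then obtain a b c d where *: "g = emb (Mat2 a b c d)" "a \<in> M" "b \<in> M" "c \<in> M" "d \<in> M" "a * d - b * c = 1" by blast
      show "g \<in> ?R" unfolding mem_Collect_eq
        by (intro exI[of _ a] exI[of _ b] exI[of _ c] exI[of _ d]) (use * emb_basis in auto)
    qed
    show "?R \<subseteq> ?L"
    proof
      fix g assume "g \<in> ?R"
      then obtain a b c d where *: "a \<in> M" "b \<in> M" "c \<in> M" "d \<in> M" "a * d - b * c = 1"
        "g *v b1 = a *s b1 + c *s b2" "g *v b2 = b *s b1 + d *s b2" "\<forall>w\<in>?W. g *v w = w" by blast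
      then have "g = emb (Mat2 a b c d)" by (intro emb_unique) auto
      then show "g \<in> ?L" using * by blast
    qed
  qed
qed

end

section \<open>The group generated by the transvections\<close>

theorem theorem3p7:
  fixes u \<phi> v \<psi> :: "'a::{field, finite} ^ 'n"
    and K \<Lambda> :: "'a set"
  assumes n2: "CARD('n) \<ge> 2"
    and s_tv: "appf \<phi> u = 0" and t_tv: "appf \<psi> v = 0"
    and psi_u: "appf \<psi> u \<noteq> 0" and phi_v: "appf \<phi> v \<noteq> 0"
    and K: "K \<subseteq> - {0}" "1 \<in> K"
    and L: "\<Lambda> \<subseteq> - {0}" "1 \<in> \<Lambda>"
    and not2: "CHAR('a) \<noteq> 2"
    and not9: "card (subfield_gen (K \<union> \<Lambda> \<union> {appf \<psi> u * appf \<phi> v})) \<noteq> 9"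
  shows "SL2_plus_id (gen_group (transv_pow u \<phi> K \<union> transv_pow v \<psi> \<Lambda>))
           (subfield_gen (K \<union> \<Lambda> \<union> {appf \<psi> u * appf \<phi> v}))"
proof -
  define \<delta> where "\<delta> = appf \<psi> u * appf \<phi> v"
  define M where "M = subfield_gen (K \<union> \<Lambda> \<union> {\<delta>})"
  define S where "S = transv_pow u \<phi> K \<union> transv_pow v \<psi> \<Lambda>"
  have \<delta>: "\<delta> \<noteq> 0" using psi_u phi_v by (simp add: \<delta>_def)
  have two: "(2::'a) \<noteq> 0"
  proof
    assume "(2::'a) = 0"
    then have "CHAR('a) dvd 2" by (metis of_nat_eq_0_iff_char_dvd of_nat_numeral)
    then have "CHAR('a) \<le> 2" by (rule dvd_imp_le) simp
    moreover have "CHAR('a) \<noteq> 0" using \<open>CHAR('a) dvd 2\<close> by (metis dvd_0_left_iff zero_neq_numeral)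
    moreover have "CHAR('a) \<noteq> 1" using CHAR_not_1' by simp
    ultimately show False using not2 by linarith
  qed
  \<comment> \<open>The dual basis of \<phi>(v)u, v consists of \<psi>/\<delta> and
    \<phi>/\<phi>(v). Scaling \<open>u\<close> by \<phi>(v) makes the upper entry exactly
    \<open>k\<close> and moves \<delta> to the lower one.\<close>
  interpret dual_pair "appf \<phi> v *s u" v "inverse \<delta> *s \<psi>" "inverse (appf \<phi> v) *s \<phi>"
    by unfold_locales (use s_tv t_tv psi_u phi_v in \<open>simp_all add: appf_scale \<delta>_def field_simps\<close>)
  have s: "transv k u \<phi> = emb (upper k)" for k
    using phi_v by (simp add: transv_def upper_def emb.simps vec_eq_iff mult_ac)
  have t: "transv l v \<psi> = emb (lower (l * \<delta>))" for l
    using \<delta> by (simp add: transv_def lower_def emb.simps vec_eq_iff mult_ac)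
  have M: "is_subfield M" unfolding M_def by (rule is_subfield_subfield_gen)
  have gens: "K \<subseteq> M" "\<Lambda> \<subseteq> M" "\<delta> \<in> M" using subset_subfield_gen[of "K \<union> \<Lambda> \<union> {\<delta>}"] by (auto simp: M_def)
  have M': "0 \<in> M" "1 \<in> M" "\<And>x y. x \<in> M \<Longrightarrow> y \<in> M \<Longrightarrow> x + y \<in> M" "\<And>x. x \<in> M \<Longrightarrow> - x \<in> M"
    "\<And>x y. x \<in> M \<Longrightarrow> y \<in> M \<Longrightarrow> x * y \<in> M"
    using M unfolding is_subfield_def by blast+
  let ?SL = "{Mat2 a b c d | a b c d. a \<in> M \<and> b \<in> M \<and> c \<in> M \<and> d \<in> M \<and> a * d - b * c = 1}"
  have SL_det: "mdet g = 1" if "g \<in> ?SL" for g using that by auto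
  \<comment> \<open>The generators have entries in \<open>M\<close>, and SL(2,M) is closed under the
    group operations.\<close>
  have "gen_group S \<subseteq> emb ` ?SL"
  proof
    fix g assume "g \<in> gen_group S"
    then show "g \<in> emb ` ?SL"
    proof induction
      case one
      have "mone \<in> ?SL" using M' by (auto simp: mone_def)
      then show ?case unfolding emb_mone[symmetric] by (rule imageI)
    next
      case (gen g)
      then consider k where "k \<in> K" "g = emb (upper k)" | l where "l \<in> \<Lambda>" "g = emb (lower (l * \<delta>))"
        unfolding S_def transv_pow_def s t by blast
      then show ?case
      proof cases
        case 1
        moreover have "upper k \<in> ?SL" using 1 gens M' by (auto simp: upper_def)
        ultimately show ?thesis by blast
      next
        case 2
        moreover have "lower (l * \<delta>) \<in> ?SL" using 2 gens M' by (auto simp: lower_def)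
        ultimately show ?thesis by blast
      qed
    next
      case (mult g h)
      then obtain g' h' where *: "g' \<in> ?SL" "g = emb g'" "h' \<in> ?SL" "h = emb h'" by blast
      have "mdet (g' \<odot> h') = 1" using SL_det[OF *(1)] SL_det[OF *(3)] by (simp add: mdet_mmul)
      moreover obtain a b c d a' b' c' d' where "g' = Mat2 a b c d" "h' = Mat2 a' b' c' d'"
        and "a \<in> M" "b \<in> M" "c \<in> M" "d \<in> M" "a' \<in> M" "b' \<in> M" "c' \<in> M" "d' \<in> M" using *(1,3) by blast
      ultimately have "g' \<odot> h' \<in> ?SL" using M' by simp
      then show ?case unfolding *(2,4) emb_mmul[symmetric] by (rule imageI)
    next
      case (inv g)
      then obtain a b c d where *: "g = emb (Mat2 a b c d)" and in_M: "a \<in> M" "b \<in> M" "c \<in> M" "d \<in> M"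
        and det: "a * d - b * c = 1" by blast
      have "minv (Mat2 a b c d) \<in> ?SL" using in_M det M'(4) by (simp add: mult.commute)
      moreover have "matrix_inv g = emb (minv (Mat2 a b c d))" unfolding * using det by (intro emb_minv) simp
      ultimately show ?case by blast
    qed
  qed
  moreover have "emb ` ?SL \<subseteq> gen_group S"
  proof -
    \<comment> \<open>Pulling back along \<open>emb\<close> turns the generated group into a group
      of two-by-two matrices, to which the results on root subgroups apply.\<close>
    define G where "G = {g. mdet g = 1 \<and> emb g \<in> gen_group S}"
    have G: "mone \<in> G" "\<And>g h. g \<in> G \<Longrightarrow> h \<in> G \<Longrightarrow> g \<odot> h \<in> G" "\<And>g. g \<in> G \<Longrightarrow> minv g \<in> G"
      "\<And>g. g \<in> G \<Longrightarrow> mdet g = 1"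
    proof -
      show "mone \<in> G" by (simp add: G_def emb_mone gen_group.one) (simp add: mone_def)
      show "g \<odot> h \<in> G" if "g \<in> G" "h \<in> G" for g h
        using that by (simp add: G_def emb_mmul mdet_mmul gen_group.mult)
      show "minv g \<in> G" if "g \<in> G" for g
      proof -
        have "mdet (minv g) = mdet g" by (cases g) (simp add: mult.commute)
        then show ?thesis using that gen_group.inv[of "emb g" S] by (simp add: G_def emb_minv)
      qed
    qed (simp add: G_def)
    have "upper k \<in> G" if "k \<in> K" for k
      using that by (auto simp: G_def S_def transv_pow_def simp flip: s intro!: gen_group.gen) (simp add: upper_def)
    moreover have "lower (l * \<delta>) \<in> G" if "l \<in> \<Lambda>" for l
      using that by (auto simp: G_def S_def transv_pow_def simp flip: t intro!: gen_group.gen) (simp add: lower_def)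
    ultimately have "upper x \<in> G" "lower x \<in> G" if "x \<in> M" for x
      using root_subgroups_mem[OF two G, of K \<Lambda> \<delta> x] K(2) L(2) \<delta> not9 that
      by (simp_all add: M_def \<delta>_def)
    then have "?SL \<subseteq> G" using SL2_generated[OF G(2) M] by blast
    then show ?thesis unfolding G_def by blast
  qed
  ultimately have "gen_group S = emb ` ?SL" by blast
  then show ?thesis using SL2_plus_id_emb[of M] by (simp add: M_def S_def \<delta>_def)
qed

end
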